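(* If $U$ and $V$ are two finite sets of numbers from $(0,1)$ and $\tau(U)\equiv \tau(V)$ (the words $\tau(U)$ and $\tau(V)$ are equal letter by letter), then the subgroups $H_U$ and $H_V$ of $F$ are isomorphic.
   Context: $F$ (R. Thompson's group) is the group of all piecewise-linear increasing self-homeomorphisms of $[0,1]$ with finitely many break points of the derivative, all lying in $\mathbb{Z}[\frac12]$, and with all slopes powers of $2$. For a finite set $U\subset(0,1)$, $H_U=\{f\in F: f(x)=x \text{ for all } x\in U\}$. If $U=\{\gamma_1<\dots<\gamma_n\}$, the type $\tau(U)$ is the word of length $n$ in the alphabet $\{1,2,3\}$ whose $j$-th letter is $1$ if $\gamma_j\in\mathbb{Z}[\frac12]$, $2$ if $\gamma_j$ is rational and not in $\mathbb{Z}[\frac12]$, and $3$ if $\gamma_j$ is irrational. *)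

theory Defs
  imports "HOL-Analysis.Analysis" "HOL-Algebra.Bij"
begin

definition dyadics :: "real set" where
  "dyadics = {x. \<exists>(a::int) (k::nat). x = of_int a / 2 ^ k}"

text \<open>The set \<open>B\<close> contains the break points; it may contain further dyadic numbers,
  at which \<open>f\<close> does not actually break. Only intervals avoiding \<open>B\<close> in their interior
  are required to be mapped affinely.\<close>

definition dyadic_PL :: "(real \<Rightarrow> real) \<Rightarrow> bool" where
  "dyadic_PL f \<longleftrightarrow>
     (\<exists>B. finite B \<and> B \<subseteq> dyadics \<and>
        (\<forall>a b. 0 \<le> a \<and> a < b \<and> b \<le> 1 \<and> {a<..<b} \<inter> B = {} \<longrightarrow>
           (\<exists>(k::int) c. \<forall>x\<in>{a..b}. f x = 2 powi k * x + c)))"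

text \<open>As in \<open>BijGroup\<close>, a self-map of \<open>[0,1]\<close> is represented by a function on the reals that
  is \<open>undefined\<close> outside \<open>[0,1]\<close>, and the product of \<open>g\<close> and \<open>f\<close> is \<open>g \<circ> f\<close> on \<open>[0,1]\<close>.\<close>

definition thompson_F :: "(real \<Rightarrow> real) monoid" where
  "thompson_F = (BijGroup {0..1})
     \<lparr>carrier := {f \<in> Bij {0..1}.
        homeomorphism {0..1} {0..1} f (inv_into {0..1} f) \<and>
        strict_mono_on {0..1} f \<and> dyadic_PL f}\<rparr>"

definition H :: "real set \<Rightarrow> (real \<Rightarrow> real) set" where
  "H U = {f \<in> carrier thompson_F. \<forall>x\<in>U. f x = x}"

definition letter :: "real \<Rightarrow> nat" where
  "letter \<gamma> = (if \<gamma> \<in> dyadics then 1 else if \<gamma> \<in> \<rat> then 2 else 3)"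

text \<open>Meaningful for finite \<open>U\<close> only.\<close>

definition \<tau> :: "real set \<Rightarrow> nat list" where
  "\<tau> U = map letter (sorted_list_of_set U)"

end

theory Submission
  imports Defs
begin

text \<open>
  Extended by the identity outside the unit interval, the elements of \<open>F\<close> become increasing
  bijections of the line that are piecewise linear with dyadic data at every point. The isomorphism
  from \<open>H U\<close> to \<open>H V\<close> is conjugation by an increasing bijection \<open>\<phi>\<close> of the line that carries
  \<open>U\<close> to \<open>V\<close> and fixes 0 and 1. In general \<open>\<phi>\<close> cannot belong to \<open>F\<close>, but it suffices that it
  is piecewise linear off \<open>U\<close>: a map \<open>f\<close> that fixes \<open>U\<close> pointwise also preserves the complement
  of \<open>U\<close>, so \<open>\<phi> \<circ> f \<circ> \<phi>\<^sup>-\<^sup>1\<close> is piecewise linear off \<open>V\<close>. Infinitely many break points of \<open>\<phi>\<close>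
  may accumulate at points of \<open>U\<close>; what remains is to control the conjugated germs there
  (\<open>PL_homeo_conj\<close>, \<open>H_iso_if_conjugating_map\<close>).

  At a dyadic point of \<open>U\<close> the map \<open>\<phi>\<close> is simply required to be piecewise linear. At a non-dyadic
  point \<open>\<gamma>\<close>, an element of \<open>F\<close> that fixes \<open>\<gamma>\<close> does not break, so near \<open>\<gamma>\<close> it is a dilation
  \<open>x \<mapsto> \<gamma> + 2\<^sup>k (x - \<gamma>)\<close>, and the exponents \<open>k\<close> that occur are those for which
  \<open>(2\<^sup>k - 1) \<gamma>\<close> is dyadic. They form the trivial group if \<open>\<gamma>\<close> is irrational and an infinite
  cyclic group if \<open>\<gamma>\<close> is rational; so at this level, too, the letter of \<open>\<gamma>\<close> decides everything. In
  the irrational case the conjugated germ is the identity whatever \<open>\<phi>\<close> is (\<open>match_irrational\<close>). In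
  the rational case \<open>\<phi>\<close> is made equivariant: it is prescribed on a fundamental domain of the
  generating dilation at \<open>\<gamma>\<close> on either side of \<open>\<gamma>\<close> and spread out by the generating dilations at
  \<open>\<gamma>\<close> and \<open>\<phi> \<gamma>\<close> (\<open>match_rational\<close>).

  The pieces exist because any two intervals with dyadic end points are related by a piecewise linear
  homeomorphism (\<open>PL_homeo_interval\<close>), and such pieces may be glued at dyadic points. Gluing along
  the sorted lists of \<open>U\<close> and \<open>V\<close> gives \<open>\<phi>\<close> (\<open>matching_map_exists\<close>).
\<close>

section \<open>Dyadic numbers\<close>

lemma dyadicsI: "of_int a / 2 ^ k \<in> dyadics"
  unfolding dyadics_def by blast

lemma of_int_dyadics [simp]: "of_int a \<in> dyadics"
  using dyadicsI[of a 0] by simp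

lemma zero_one_dyadics [simp]: "0 \<in> dyadics" "1 \<in> dyadics"
  using of_int_dyadics[of 0] of_int_dyadics[of 1] by auto

lemma dyadics_add: assumes "x \<in> dyadics" "y \<in> dyadics" shows "x + y \<in> dyadics"
proof -
  obtain a k b l where "x = of_int a / 2 ^ k" "y = of_int b / 2 ^ l"
    using assms unfolding dyadics_def by auto
  then have "x + y = of_int (a * 2 ^ l + b * 2 ^ k) / 2 ^ (k + l)"
    by (simp add: power_add add_frac_eq)
  then show ?thesis by (metis dyadicsI)
qed

lemma dyadics_mult: assumes "x \<in> dyadics" "y \<in> dyadics" shows "x * y \<in> dyadics"
proof -
  obtain a k b l where "x = of_int a / 2 ^ k" "y = of_int b / 2 ^ l"
    using assms unfolding dyadics_def by auto
  then have "x * y = of_int (a * b) / 2 ^ (k + l)"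
    by (simp add: power_add)
  then show ?thesis by (metis dyadicsI)
qed

lemma dyadics_minus: "x \<in> dyadics \<Longrightarrow> - x \<in> dyadics"
  using dyadics_mult[OF of_int_dyadics[of "-1"], of x] by simp

lemma dyadics_diff: "x \<in> dyadics \<Longrightarrow> y \<in> dyadics \<Longrightarrow> x - y \<in> dyadics"
  using dyadics_add[of x "- y"] dyadics_minus by auto

lemma dyadics_powi [simp]: "2 powi k \<in> dyadics"
proof (cases "k \<ge> 0")
  case True
  then show ?thesis using of_int_dyadics[of "2 ^ nat k"] by (simp add: power_int_def)
next
  case False
  then show ?thesis using dyadicsI[of 1 "nat (-k)"] by (simp add: power_int_def field_simps)
qed

lemma dyadics_powi_mult_iff [simp]: "2 powi k * x \<in> dyadics \<longleftrightarrow> x \<in> dyadics"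
proof
  assume "2 powi k * x \<in> dyadics"
  then have "2 powi (-k) * (2 powi k * x) \<in> dyadics" by (rule dyadics_mult[OF dyadics_powi])
  moreover have "2 powi (-k) * (2 powi k * x) = x" by (simp add: power_int_minus)
  ultimately show "x \<in> dyadics" by simp
qed (auto intro: dyadics_mult)

lemma dyadics_add_iff: "c \<in> dyadics \<Longrightarrow> x + c \<in> dyadics \<longleftrightarrow> x \<in> dyadics"
  using dyadics_add[of x c] dyadics_diff[of "x + c" c] by auto

lemma dyadics_dense:
  assumes "x < y" obtains d where "d \<in> dyadics" "x < d" "d < y"
proof -
  obtain n :: nat where n: "1 / (y - x) < 2 ^ n"
    using real_arch_pow[of 2 "1 / (y - x)"] by auto
  then have 1: "1 < 2 ^ n * (y - x)" using assms by (simp add: field_simps)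
  define d where "d = of_int (\<lfloor>2 ^ n * x\<rfloor> + 1) / (2::real) ^ n"
  have "2 ^ n * x < of_int (\<lfloor>2 ^ n * x\<rfloor> + 1)" "of_int (\<lfloor>2 ^ n * x\<rfloor> + 1) < 2 ^ n * y"
    using 1 unfolding right_diff_distrib by linarith+
  then have "x < d" "d < y" unfolding d_def by (simp_all add: field_simps)
  then show thesis using that dyadicsI unfolding d_def by blast
qed

section \<open>Germs of dyadic affine maps\<close>

text \<open>The translation part is required to be dyadic so that these maps form a group that preserves
the dyadic numbers. For the pieces of an element of \<open>F\<close> this is automatic, see
\<open>dyadic_PL_dyadic_value\<close>.\<close>

definition dyadic_affine :: "(real \<Rightarrow> real) set" where
  "dyadic_affine = {\<lambda>x. 2 powi k * x + c | k c. c \<in> dyadics}"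

lemma dyadic_affineI: "c \<in> dyadics \<Longrightarrow> (\<lambda>x. 2 powi k * x + c) \<in> dyadic_affine"
  unfolding dyadic_affine_def by blast

lemma dyadic_affineE:
  assumes "\<alpha> \<in> dyadic_affine"
  obtains k c where "c \<in> dyadics" "\<alpha> = (\<lambda>x. 2 powi k * x + c)"
  using assms unfolding dyadic_affine_def by blast

lemma dyadic_affine_dyadics_iff: "\<alpha> \<in> dyadic_affine \<Longrightarrow> \<alpha> x \<in> dyadics \<longleftrightarrow> x \<in> dyadics"
  by (elim dyadic_affineE) (simp add: dyadics_add_iff)

lemma dyadic_affine_translation: "c \<in> dyadics \<Longrightarrow> (\<lambda>x. x + c) \<in> dyadic_affine"
  using dyadic_affineI[of c 0] by simp

lemma dyadic_affine_id: "(\<lambda>x. x) \<in> dyadic_affine"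
  using dyadic_affine_translation[of 0] by simp

lemma dyadic_affine_comp:
  assumes "\<alpha> \<in> dyadic_affine" "\<beta> \<in> dyadic_affine" shows "\<beta> \<circ> \<alpha> \<in> dyadic_affine"
proof -
  obtain k c l d where *: "c \<in> dyadics" "\<alpha> = (\<lambda>x. 2 powi k * x + c)"
     "d \<in> dyadics" "\<beta> = (\<lambda>x. 2 powi l * x + d)"
    using assms by (metis dyadic_affineE)
  have "\<beta> \<circ> \<alpha> = (\<lambda>x. 2 powi (l + k) * x + (2 powi l * c + d))"
    unfolding * by (auto simp: power_int_add algebra_simps)
  also have "\<dots> \<in> dyadic_affine" using * by (intro dyadic_affineI dyadics_add) auto
  finally show ?thesis .
qed

lemma dyadic_affine_inverse:
  assumes "\<alpha> \<in> dyadic_affine"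
  obtains \<beta> where "\<beta> \<in> dyadic_affine" "\<And>x. \<beta> (\<alpha> x) = x"
proof -
  obtain k c where *: "c \<in> dyadics" "\<alpha> = (\<lambda>x. 2 powi k * x + c)"
    using assms by (metis dyadic_affineE)
  have "(\<lambda>x. 2 powi (-k) * x + - (2 powi (-k) * c)) \<in> dyadic_affine"
    using * by (intro dyadic_affineI dyadics_minus) auto
  moreover have "2 powi (-k) * \<alpha> x + - (2 powi (-k) * c) = x" for x
    unfolding * by (simp add: power_int_minus field_simps)
  ultimately show thesis using that by blast
qed

lemma dyadic_affine_strict_mono: "\<alpha> \<in> dyadic_affine \<Longrightarrow> strict_mono \<alpha>"
  by (elim dyadic_affineE) (auto simp: strict_mono_def)

lemma dyadic_affine_surj: "\<alpha> \<in> dyadic_affine \<Longrightarrow> surj \<alpha>"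
proof (elim dyadic_affineE)
  fix k c assume *: "\<alpha> = (\<lambda>x. 2 powi k * x + c)"
  show ?thesis unfolding surj_def
  proof
    fix y
    have "y = \<alpha> ((y - c) / 2 powi k)" unfolding * by simp
    then show "\<exists>x. y = \<alpha> x" ..
  qed
qed

text \<open>A pointwise form of piecewise linearity: two one-sided germs, which may differ only at a dyadic
point. Unlike a condition on the set of all break points, it can be imposed off \<open>U\<close> alone.\<close>

definition PL_at :: "(real \<Rightarrow> real) \<Rightarrow> real \<Rightarrow> bool" where
  "PL_at f x \<longleftrightarrow> (\<exists>\<alpha>\<in>dyadic_affine. \<exists>\<beta>\<in>dyadic_affine.
     f x = \<alpha> x \<and> f x = \<beta> x \<and>
     (\<forall>\<^sub>F y in at_left x. f y = \<alpha> y) \<and> (\<forall>\<^sub>F y in at_right x. f y = \<beta> y) \<and>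
     (x \<notin> dyadics \<longrightarrow> \<alpha> = \<beta>))"

lemma PL_atI:
  assumes "\<alpha> \<in> dyadic_affine" "\<beta> \<in> dyadic_affine" "f x = \<alpha> x" "f x = \<beta> x"
    "\<forall>\<^sub>F y in at_left x. f y = \<alpha> y" "\<forall>\<^sub>F y in at_right x. f y = \<beta> y" "x \<in> dyadics \<or> \<alpha> = \<beta>"
  shows "PL_at f x"
  using assms unfolding PL_at_def by blast

lemma PL_atE:
  assumes "PL_at f x"
  obtains \<alpha> \<beta> where "\<alpha> \<in> dyadic_affine" "\<beta> \<in> dyadic_affine" "f x = \<alpha> x" "f x = \<beta> x"
    "\<forall>\<^sub>F y in at_left x. f y = \<alpha> y" "\<forall>\<^sub>F y in at_right x. f y = \<beta> y" "x \<in> dyadics \<or> \<alpha> = \<beta>"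
  using assms unfolding PL_at_def by blast

lemma eventually_nhds_split_real:
  "eventually P (nhds (x::real)) \<longleftrightarrow> eventually P (at_left x) \<and> P x \<and> eventually P (at_right x)"
  unfolding eventually_nhds_conv_at eventually_at_split by auto

lemma PL_at_if_affine_near:
  assumes "\<alpha> \<in> dyadic_affine" "\<forall>\<^sub>F y in nhds x. f y = \<alpha> y" shows "PL_at f x"
  using assms by (intro PL_atI[of \<alpha> \<alpha>]) (auto simp: eventually_nhds_split_real)

lemma affine_near_if_PL_at:
  assumes "PL_at f x" "x \<notin> dyadics"
  obtains \<alpha> where "\<alpha> \<in> dyadic_affine" "\<forall>\<^sub>F y in nhds x. f y = \<alpha> y"
  using assms(1)
proof (rule PL_atE)
  fix \<alpha> \<beta>
  assume *: "\<alpha> \<in> dyadic_affine" "f x = \<alpha> x" "\<forall>\<^sub>F y in at_left x. f y = \<alpha> y"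
    "\<forall>\<^sub>F y in at_right x. f y = \<beta> y" "x \<in> dyadics \<or> \<alpha> = \<beta>"
  show thesis using that[OF *(1)] *(2-5) assms(2) unfolding eventually_nhds_split_real by blast
qed

lemma PL_at_affine: "\<alpha> \<in> dyadic_affine \<Longrightarrow> PL_at \<alpha> x"
  by (rule PL_at_if_affine_near) auto

lemma PL_at_cong:
  assumes "\<forall>\<^sub>F y in nhds x. f y = g y" "PL_at f x" shows "PL_at g x"
proof -
  obtain \<alpha> \<beta> where *: "\<alpha> \<in> dyadic_affine" "\<beta> \<in> dyadic_affine" "f x = \<alpha> x" "f x = \<beta> x"
    "\<forall>\<^sub>F y in at_left x. f y = \<alpha> y" "\<forall>\<^sub>F y in at_right x. f y = \<beta> y" "x \<in> dyadics \<or> \<alpha> = \<beta>"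
    using assms(2) by (rule PL_atE)
  have e: "\<forall>\<^sub>F y in at_left x. f y = g y" "f x = g x" "\<forall>\<^sub>F y in at_right x. f y = g y"
    using assms(1) by (auto simp: eventually_nhds_split_real)
  show ?thesis
  proof (rule PL_atI[OF *(1,2)])
    show "\<forall>\<^sub>F y in at_left x. g y = \<alpha> y" using *(5) e(1) by eventually_elim simp
    show "\<forall>\<^sub>F y in at_right x. g y = \<beta> y" using *(6) e(3) by eventually_elim simp
  qed (metis *(3) e(2), metis *(4) e(2), rule *(7))
qed

lemma PL_at_dyadics_iff: "PL_at f x \<Longrightarrow> f x \<in> dyadics \<longleftrightarrow> x \<in> dyadics"
  by (elim PL_atE) (auto simp: dyadic_affine_dyadics_iff)

section \<open>Increasing bijections of the real line\<close>

definition increasing_bij :: "(real \<Rightarrow> real) \<Rightarrow> bool" where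
  "increasing_bij f \<longleftrightarrow> strict_mono f \<and> surj f"

text \<open>The usual name of the inverse function denotes the inverse in a group here.\<close>

abbreviation rinv :: "(real \<Rightarrow> real) \<Rightarrow> real \<Rightarrow> real" where
  "rinv f \<equiv> inv_into UNIV f"

lemma increasing_bij_less_iff: "increasing_bij f \<Longrightarrow> f x < f y \<longleftrightarrow> x < y"
  unfolding increasing_bij_def using strict_mono_less by blast

lemma increasing_bij_le_iff: "increasing_bij f \<Longrightarrow> f x \<le> f y \<longleftrightarrow> x \<le> y"
  unfolding increasing_bij_def using strict_mono_less_eq by blast

lemma increasing_bij_inj: "increasing_bij f \<Longrightarrow> inj f"
  unfolding increasing_bij_def using strict_mono_imp_inj_on by blast

lemma increasing_bij_surj: "increasing_bij f \<Longrightarrow> surj f"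
  unfolding increasing_bij_def by blast

lemma increasing_bij_inv_f: "increasing_bij f \<Longrightarrow> rinv f (f x) = x"
  using increasing_bij_inj by (rule inv_f_f)

lemma increasing_bij_f_inv: "increasing_bij f \<Longrightarrow> f (rinv f x) = x"
  using increasing_bij_surj by (rule surj_f_inv_f)

lemma increasing_bij_inv: assumes "increasing_bij f" shows "increasing_bij (rinv f)"
  unfolding increasing_bij_def strict_mono_def
proof (intro conjI allI impI)
  show "rinv f x < rinv f y" if "x < y" for x y
    using that increasing_bij_less_iff[OF assms, of "rinv f x" "rinv f y"] increasing_bij_f_inv[OF assms]
    by simp
  show "surj (rinv f)" by (rule surjI[where f = f]) (rule increasing_bij_inv_f[OF assms])
qed

lemma increasing_bij_comp: "increasing_bij f \<Longrightarrow> increasing_bij g \<Longrightarrow> increasing_bij (g \<circ> f)"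
  unfolding increasing_bij_def using strict_mono_o comp_surj by blast

lemma increasing_bij_affine: "\<alpha> \<in> dyadic_affine \<Longrightarrow> increasing_bij \<alpha>"
  unfolding increasing_bij_def using dyadic_affine_strict_mono dyadic_affine_surj by blast

lemma increasing_bij_isCont: assumes "increasing_bij f" shows "isCont f x"
proof -
  have "continuous_on UNIV f"
    using assms by (intro continuous_onI_mono)
      (auto simp: increasing_bij_surj increasing_bij_le_iff)
  then show ?thesis by (simp add: continuous_on_eq_continuous_at)
qed

text \<open>Increasing bijections carry one-sided neighbourhoods to one-sided neighbourhoods; this is what
lets one-sided germs be composed and inverted.\<close>

lemma increasing_bij_filterlim:
  assumes "increasing_bij f"
  shows "filterlim f (nhds (f x)) (nhds x)"
    and "filterlim f (at_left (f x)) (at_left x)"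
    and "filterlim f (at_right (f x)) (at_right x)"
proof -
  have c: "f \<midarrow>x\<rightarrow> f x" using increasing_bij_isCont[OF assms] by (simp add: isCont_def)
  then show "filterlim f (nhds (f x)) (nhds x)"
    by (simp add: tendsto_at_iff_tendsto_nhds)
  show "filterlim f (at_left (f x)) (at_left x)"
    unfolding filterlim_at using c assms
    by (auto simp: increasing_bij_less_iff filterlim_at_split eventually_at_filter
        increasing_bij_inj[THEN inj_eq])
  show "filterlim f (at_right (f x)) (at_right x)"
    unfolding filterlim_at using c assms
    by (auto simp: increasing_bij_less_iff filterlim_at_split eventually_at_filter
        increasing_bij_inj[THEN inj_eq])
qed

lemma PL_at_comp:
  assumes f: "increasing_bij f" and F: "PL_at f x" and G: "PL_at g (f x)"
  shows "PL_at (g \<circ> f) x"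
proof -
  obtain \<alpha> \<beta> where a: "\<alpha> \<in> dyadic_affine" "\<beta> \<in> dyadic_affine" "f x = \<alpha> x" "f x = \<beta> x"
    "\<forall>\<^sub>F y in at_left x. f y = \<alpha> y" "\<forall>\<^sub>F y in at_right x. f y = \<beta> y" "x \<in> dyadics \<or> \<alpha> = \<beta>"
    using F by (rule PL_atE)
  obtain \<alpha>' \<beta>' where b: "\<alpha>' \<in> dyadic_affine" "\<beta>' \<in> dyadic_affine"
    "g (f x) = \<alpha>' (f x)" "g (f x) = \<beta>' (f x)"
    "\<forall>\<^sub>F y in at_left (f x). g y = \<alpha>' y" "\<forall>\<^sub>F y in at_right (f x). g y = \<beta>' y"
    "f x \<in> dyadics \<or> \<alpha>' = \<beta>'"
    using G by (rule PL_atE)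
  have l: "\<forall>\<^sub>F y in at_left x. g (f y) = \<alpha>' (f y)"
    and r: "\<forall>\<^sub>F y in at_right x. g (f y) = \<beta>' (f y)"
    using increasing_bij_filterlim(2,3)[OF f, of x] b(5,6)
    by (auto dest: filterlim_compose simp: filterlim_iff)
  show ?thesis
  proof (rule PL_atI[OF dyadic_affine_comp[OF a(1) b(1)] dyadic_affine_comp[OF a(2) b(2)]])
    show "\<forall>\<^sub>F y in at_left x. (g \<circ> f) y = (\<alpha>' \<circ> \<alpha>) y" using l a(5) by eventually_elim simp
    show "\<forall>\<^sub>F y in at_right x. (g \<circ> f) y = (\<beta>' \<circ> \<beta>) y" using r a(6) by eventually_elim simp
    show "x \<in> dyadics \<or> \<alpha>' \<circ> \<alpha> = \<beta>' \<circ> \<beta>"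
      using a(7) b(7) PL_at_dyadics_iff[OF F] by auto
  qed (metis a(3) b(3) comp_apply, metis a(4) b(4) comp_apply)
qed

lemma PL_at_inv:
  assumes f: "increasing_bij f" and F: "PL_at f x"
  shows "PL_at (rinv f) (f x)"
proof -
  note inv = increasing_bij_inv_f[OF f] increasing_bij_f_inv[OF f]
  obtain \<alpha> \<beta> where a: "\<alpha> \<in> dyadic_affine" "\<beta> \<in> dyadic_affine" "f x = \<alpha> x" "f x = \<beta> x"
    "\<forall>\<^sub>F y in at_left x. f y = \<alpha> y" "\<forall>\<^sub>F y in at_right x. f y = \<beta> y" "x \<in> dyadics \<or> \<alpha> = \<beta>"
    using F by (rule PL_atE)
  obtain \<alpha>' where a': "\<alpha>' \<in> dyadic_affine" "\<And>x. \<alpha>' (\<alpha> x) = x"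
    using a(1) dyadic_affine_inverse by metis
  obtain \<beta>' where b': "\<beta>' \<in> dyadic_affine" "\<And>x. \<beta>' (\<beta> x) = x" "\<alpha> = \<beta> \<longrightarrow> \<alpha>' = \<beta>'"
    using a(2) a' dyadic_affine_inverse by metis
  have l: "\<forall>\<^sub>F y in at_left (f x). f (rinv f y) = \<alpha> (rinv f y)"
    and r: "\<forall>\<^sub>F y in at_right (f x). f (rinv f y) = \<beta> (rinv f y)"
    using increasing_bij_filterlim(2,3)[OF increasing_bij_inv[OF f], of "f x"] a(5,6)
    by (auto simp: filterlim_iff inv)
  show ?thesis
  proof (rule PL_atI[OF a'(1) b'(1)])
    show "\<forall>\<^sub>F y in at_left (f x). rinv f y = \<alpha>' y" using l by eventually_elim (metis inv(2) a'(2))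
    show "\<forall>\<^sub>F y in at_right (f x). rinv f y = \<beta>' y" using r by eventually_elim (metis inv(2) b'(2))
    show "rinv f (f x) = \<alpha>' (f x)" using a(3) a'(2) inv(1) by metis
    show "rinv f (f x) = \<beta>' (f x)" using a(4) b'(2) inv(1) by metis
    show "f x \<in> dyadics \<or> \<alpha>' = \<beta>'"
      using a(7) b'(3) PL_at_dyadics_iff[OF F] by auto
  qed
qed

definition glue :: "real \<Rightarrow> (real \<Rightarrow> real) \<Rightarrow> (real \<Rightarrow> real) \<Rightarrow> real \<Rightarrow> real" where
  "glue r f g x = (if x \<le> r then f x else g x)"

lemma glue_near_left: "x < r \<Longrightarrow> \<forall>\<^sub>F y in nhds x. f y = glue r f g y"
  using eventually_nhds_in_open[of "{..<r}" x] by (auto simp: glue_def elim: eventually_mono)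

lemma glue_near_right: "r < x \<Longrightarrow> \<forall>\<^sub>F y in nhds x. g y = glue r f g y"
  using eventually_nhds_in_open[of "{r<..}" x] by (auto simp: glue_def elim: eventually_mono)

lemma increasing_bij_glue:
  assumes f: "increasing_bij f" and g: "increasing_bij g" and "f r = g r"
  shows "increasing_bij (glue r f g)"
  unfolding increasing_bij_def
proof
  show "strict_mono (glue r f g)"
  proof (rule strict_monoI)
    fix x y :: real assume "x < y"
    have "f x < g y" if "x \<le> r" "r < y"
      using that assms(3) increasing_bij_le_iff[OF f, of x r] increasing_bij_less_iff[OF g, of r y]
      by linarith
    then show "glue r f g x < glue r f g y"
      using \<open>x < y\<close> f g by (auto simp: glue_def increasing_bij_less_iff)
  qed
  have "\<exists>x. y = glue r f g x" for y
  proof (cases "y \<le> f r")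
    case True
    then have "rinv f y \<le> r" using increasing_bij_le_iff[OF f, of "rinv f y" r] increasing_bij_f_inv[OF f] by simp
    then show ?thesis
      by (intro exI[of _ "rinv f y"]) (simp add: glue_def increasing_bij_f_inv[OF f])
  next
    case False
    then have "\<not> rinv g y \<le> r" using assms(3) increasing_bij_le_iff[OF g, of "rinv g y" r] increasing_bij_f_inv[OF g] by simp
    then show ?thesis
      by (intro exI[of _ "rinv g y"]) (simp add: glue_def increasing_bij_f_inv[OF g])
  qed
  then show "surj (glue r f g)" unfolding surj_def by blast
qed

lemma PL_at_glue_joint:
  assumes "PL_at f r" "PL_at g r" "f r = g r" "r \<in> dyadics"
  shows "PL_at (glue r f g) r"
proof -
  obtain \<alpha> where a: "\<alpha> \<in> dyadic_affine" "f r = \<alpha> r" "\<forall>\<^sub>F y in at_left r. f y = \<alpha> y"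
    using assms(1) by (elim PL_atE)
  obtain \<beta> where b: "\<beta> \<in> dyadic_affine" "g r = \<beta> r" "\<forall>\<^sub>F y in at_right r. g y = \<beta> y"
    using assms(2) by (elim PL_atE)
  show ?thesis
  proof (rule PL_atI[OF a(1) b(1)])
    show "\<forall>\<^sub>F y in at_left r. glue r f g y = \<alpha> y"
      using a(3) by (auto simp: eventually_at_filter glue_def elim: eventually_mono)
    show "\<forall>\<^sub>F y in at_right r. glue r f g y = \<beta> y"
      using b(3) by (auto simp: eventually_at_filter glue_def elim: eventually_mono)
  qed (use a(2) b(2) assms(3,4) in \<open>simp_all add: glue_def\<close>)
qed

section \<open>PL homeomorphisms of the line\<close>

definition PL_homeo :: "(real \<Rightarrow> real) \<Rightarrow> bool" where
  "PL_homeo f \<longleftrightarrow> increasing_bij f \<and> (\<forall>x. PL_at f x)"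

lemma PL_homeo_comp: "PL_homeo f \<Longrightarrow> PL_homeo g \<Longrightarrow> PL_homeo (g \<circ> f)"
  unfolding PL_homeo_def using increasing_bij_comp PL_at_comp by blast

lemma PL_homeo_rinv: assumes "PL_homeo f" shows "PL_homeo (rinv f)"
proof -
  have f: "increasing_bij f" using assms PL_homeo_def by blast
  have "PL_at (rinv f) x" for x
    using PL_at_inv[OF f, of "rinv f x"] assms increasing_bij_f_inv[OF f]
    by (simp add: PL_homeo_def)
  then show ?thesis using increasing_bij_inv[OF f] PL_homeo_def by blast
qed

lemma PL_homeo_affine: "\<alpha> \<in> dyadic_affine \<Longrightarrow> PL_homeo \<alpha>"
  unfolding PL_homeo_def using increasing_bij_affine PL_at_affine by blast

lemma PL_homeo_glue:
  assumes "PL_homeo f" "PL_homeo g" "f r = g r" "r \<in> dyadics"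
  shows "PL_homeo (glue r f g)"
proof -
  have "PL_at (glue r f g) x" for x
  proof (cases x r rule: linorder_cases)
    case less
    then show ?thesis using PL_at_cong[OF glue_near_left] assms(1) PL_homeo_def by blast
  next
    case equal
    then show ?thesis using PL_at_glue_joint assms PL_homeo_def by blast
  next
    case greater
    then show ?thesis using PL_at_cong[OF glue_near_right] assms(2) PL_homeo_def by blast
  qed
  then show ?thesis using increasing_bij_glue assms PL_homeo_def by blast
qed

text \<open>The lengths that a piecewise linear map fixing 0 can give to \<open>[0,1]\<close> include all positive
integers, as a map that doubles \<open>[0,1]\<close> and translates everything above it by 1 takes \<open>n\<close> to
\<open>n + 1\<close>. Scaling by a power of 2 then gives all positive dyadic lengths.\<close>

lemma PL_homeo_unit_to_nat:
  assumes "n > 0" obtains f where "PL_homeo f" "f 0 = 0" "f 1 = real n"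
  using assms
proof (induction n arbitrary: thesis rule: nat_induct_non_zero)
  case 1
  then show ?case using PL_homeo_affine[OF dyadic_affine_id] by simp
next
  case (Suc n)
  obtain f where f: "PL_homeo f" "f 0 = 0" "f 1 = real n" using Suc.IH by blast
  define g where "g = glue 0 (\<lambda>x. x) (glue 1 (\<lambda>x. 2 powi 1 * x + 0) (\<lambda>x. x + 1))"
  have "PL_homeo g" unfolding g_def
    by (intro PL_homeo_glue PL_homeo_affine dyadic_affine_id dyadic_affineI
        dyadic_affine_translation) (auto simp: glue_def)
  moreover have "g 0 = 0" "g (real n) = real (Suc n)" using Suc.hyps by (auto simp: g_def glue_def)
  ultimately show ?case using f by (intro Suc.prems[OF PL_homeo_comp[of f g]]) auto
qed

lemma PL_homeo_unit_to_dyadic: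
  assumes "d \<in> dyadics" "d > 0" obtains f where "PL_homeo f" "f 0 = 0" "f 1 = d"
proof -
  obtain a k where a: "d = of_int a / 2 ^ k" using assms(1) unfolding dyadics_def by auto
  then have "a > 0" using assms(2) by (simp add: zero_less_divide_iff)
  then have d: "d = 2 powi (- int k) * real (nat a)" using a by (simp add: power_int_minus field_simps)
  obtain f where f: "PL_homeo f" "f 0 = 0" "f 1 = real (nat a)"
    using PL_homeo_unit_to_nat[of "nat a"] \<open>a > 0\<close> by auto
  have "PL_homeo ((\<lambda>x. 2 powi (- int k) * x + 0) \<circ> f)"
    by (intro PL_homeo_comp f PL_homeo_affine dyadic_affineI) auto
  then show thesis using that f d by fastforce
qed

text \<open>Both intervals are images of the unit interval, up to translation.\<close>

lemma PL_homeo_interval: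
  assumes "a \<in> dyadics" "b \<in> dyadics" "c \<in> dyadics" "d \<in> dyadics" "a < b" "c < d"
  obtains f where "PL_homeo f" "f a = c" "f b = d"
proof -
  obtain f where f: "PL_homeo f" "f 0 = 0" "f 1 = b - a"
    using PL_homeo_unit_to_dyadic[of "b - a"] assms dyadics_diff by auto
  obtain g where g: "PL_homeo g" "g 0 = 0" "g 1 = d - c"
    using PL_homeo_unit_to_dyadic[of "d - c"] assms dyadics_diff by auto
  have inv: "rinv f 0 = 0" "rinv f (b - a) = 1"
    using f increasing_bij_inv_f[of f] PL_homeo_def by metis+
  define h where "h = (\<lambda>x. x + c) \<circ> (g \<circ> (rinv f \<circ> (\<lambda>x. x + (- a))))"
  have "PL_homeo h" unfolding h_def using f g assms
    by (intro PL_homeo_comp PL_homeo_affine[OF dyadic_affine_translation] PL_homeo_rinv dyadics_minus)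
  moreover have "h a = c" "h b = d" using inv g by (simp_all add: h_def)
  ultimately show thesis using that by blast
qed

section \<open>Thompson's group acting on the line\<close>

text \<open>Extending to the whole line removes all domain conditions from compositions and inverses, and no
new break points arise except possibly at the dyadic numbers 0 and 1.\<close>

definition extend_id :: "(real \<Rightarrow> real) \<Rightarrow> real \<Rightarrow> real" where
  "extend_id f x = (if x \<in> {0..1} then f x else x)"

text \<open>Going from left to right through the break points, the value at each one differs from the previous
value by a power of 2 times a dyadic number. The least counterexample among \<open>0\<close>, \<open>x\<close> and the
break points turns this into a proof.\<close>

lemma dyadic_PL_dyadic_value:
  assumes "dyadic_PL f" "f 0 \<in> dyadics" "x \<in> dyadics" "0 \<le> x" "x \<le> 1"
  shows "f x \<in> dyadics"
proof (rule ccontr)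
  assume x: "f x \<notin> dyadics"
  obtain B where B: "finite B" "B \<subseteq> dyadics" and aff:
    "\<And>a b. 0 \<le> a \<Longrightarrow> a < b \<Longrightarrow> b \<le> 1 \<Longrightarrow> {a<..<b} \<inter> B = {} \<Longrightarrow>
           \<exists>(k::int) c. \<forall>x\<in>{a..b}. f x = 2 powi k * x + c"
    using assms(1) unfolding dyadic_PL_def by metis
  define C where "C = insert 0 (insert x (B \<inter> {0..1}))"
  have C: "finite C" "C \<subseteq> dyadics" "C \<subseteq> {0..1}" using B assms by (auto simp: C_def)
  define y where "y = Min {z \<in> C. f z \<notin> dyadics}"
  have "y \<in> {z \<in> C. f z \<notin> dyadics}"
    unfolding y_def
  proof (rule Min_in)
    show "{z \<in> C. f z \<notin> dyadics} \<noteq> {}" using x by (auto simp: C_def)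
  qed (use C(1) in auto)
  then have y: "y \<in> C" "f y \<notin> dyadics" by auto
  have below: "f z \<in> dyadics" if "z \<in> C" "z < y" for z
    using that C(1) Min_le[of "{z \<in> C. f z \<notin> dyadics}" z] unfolding y_def by fastforce
  have "y \<noteq> 0" using y assms(2) by blast
  then have "0 < y" using y C(3) by force
  define p where "p = Max {z \<in> C. z < y}"
  have "p \<in> {z \<in> C. z < y}"
    unfolding p_def
  proof (rule Max_in)
    show "{z \<in> C. z < y} \<noteq> {}" using \<open>0 < y\<close> by (auto simp: C_def)
  qed (use C(1) in auto)
  then have p: "p \<in> C" "p < y" by auto
  have "z \<le> p" if "z \<in> C" "z < y" for z
    unfolding p_def by (rule Max_ge) (use that C in auto)
  then have "{p<..<y} \<inter> C = {}" by fastforce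
  moreover have "{p<..<y} \<inter> B \<subseteq> {p<..<y} \<inter> C" using p y C(3) by (fastforce simp: C_def)
  ultimately have "{p<..<y} \<inter> B = {}" by blast
  then obtain k c where kc: "\<forall>x\<in>{p..y}. f x = 2 powi k * x + c"
    using aff[of p y] p y C(3) by (metis atLeastAtMost_iff subsetD)
  have fy: "f y = 2 powi k * y + c" and fp: "f p = 2 powi k * p + c"
    using kc p by auto
  then have "f y = f p + 2 powi k * (y - p)" by (simp add: algebra_simps)
  moreover have "f p + 2 powi k * (y - p) \<in> dyadics"
    using below[OF p] p y C(2) by (intro dyadics_add dyadics_mult dyadics_diff) auto
  ultimately show False using y by simp
qed

text \<open>An affine piece \<open>2\<^sup>k y + c\<close> of \<open>f\<close> takes a dyadic value at a dyadic point in its interior, so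
\<open>c\<close> is dyadic. Hence the pieces on the two sides of a point are germs of dyadic affine maps.\<close>

lemma thompson_F_memD:
  assumes "f \<in> carrier thompson_F"
  shows "f \<in> extensional {0..1}" and "PL_homeo (extend_id f)"
proof -
  have f: "bij_betw f {0..1} {0..1}" "strict_mono_on {0..1} f" "dyadic_PL f"
    and e: "f \<in> extensional {0..1}"
    using assms by (auto simp: thompson_F_def Bij_def)
  show "f \<in> extensional {0..1}" by (rule e)
  have im: "f x \<in> {0..1}" if "x \<in> {0..1}" for x using f(1) that bij_betwE by blast
  have mono: "strict_mono (extend_id f)"
  proof (rule strict_monoI)
    fix x y :: real assume "x < y"
    then show "extend_id f x < extend_id f y"
      using im[of x] im[of y] strict_mono_onD[OF f(2), of x y] by (auto simp: extend_id_def)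
  qed
  have "\<exists>x. y = extend_id f x" for y
  proof (cases "y \<in> {0..1}")
    case True
    then obtain x where "x \<in> {0..1}" "f x = y" using f(1) by (metis bij_betw_imp_surj_on imageE)
    then show ?thesis by (intro exI[of _ x]) (simp add: extend_id_def)
  next
    case False
    then show ?thesis by (intro exI[of _ y]) (auto simp: extend_id_def)
  qed
  then have bij: "increasing_bij (extend_id f)" using mono unfolding increasing_bij_def surj_def by blast
  have f0: "f 0 = 0"
  proof -
    obtain x where "x \<in> {0..1}" "f x = 0" using f(1) by (metis atLeastAtMost_iff bij_betw_imp_surj_on imageE order_refl zero_le_one)
    then show ?thesis using strict_mono_onD[OF f(2), of 0 x] im[of 0] by (cases "x = 0") auto
  qed
  have f1: "f 1 = 1"
  proof -
    obtain x where "x \<in> {0..1}" "f x = 1" using f(1) by (metis atLeastAtMost_iff bij_betw_imp_surj_on imageE order_refl zero_le_one)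
    then show ?thesis using strict_mono_onD[OF f(2), of x 1] im[of 1] by (cases "x = 1") auto
  qed
  obtain B where B: "finite B" "B \<subseteq> dyadics" and aff:
    "\<And>a b. 0 \<le> a \<Longrightarrow> a < b \<Longrightarrow> b \<le> 1 \<Longrightarrow> {a<..<b} \<inter> B = {} \<Longrightarrow>
           \<exists>(k::int) c. \<forall>x\<in>{a..b}. f x = 2 powi k * x + c"
    using f(3) unfolding dyadic_PL_def by metis
  have germ: "\<exists>\<alpha>\<in>dyadic_affine. \<forall>x\<in>{a..b}. f x = \<alpha> x"
    if ab: "0 \<le> a" "a < b" "b \<le> 1" "{a<..<b} \<inter> B = {}" for a b
  proof -
    obtain k c where kc: "\<forall>x\<in>{a..b}. f x = 2 powi k * x + c" using aff ab by blast
    obtain d where d: "d \<in> dyadics" "a < d" "d < b" using dyadics_dense ab(2) by blast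
    have "f d \<in> dyadics" using dyadic_PL_dyadic_value[OF f(3)] f0 d ab by simp
    moreover have "c = f d - 2 powi k * d" using kc d by simp
    ultimately have "c \<in> dyadics" using d(1) by (simp add: dyadics_diff)
    then show ?thesis using kc dyadic_affineI by fastforce
  qed
  have "PL_at (extend_id f) x" for x
  proof (cases "x \<in> {0..1}")
    case False
    then have "\<forall>\<^sub>F y in nhds x. y \<in> - {0..1}"
      by (intro eventually_nhds_in_open) auto
    then have "\<forall>\<^sub>F y in nhds x. extend_id f y = y" by eventually_elim (auto simp: extend_id_def)
    then show ?thesis using PL_at_if_affine_near[OF dyadic_affine_id] by blast
  next
    case True
    obtain \<delta> where \<delta>: "\<delta> > 0" "\<And>z. z \<in> B \<Longrightarrow> z \<noteq> x \<Longrightarrow> \<delta> \<le> dist x z"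
      using finite_set_avoid[OF B(1), of x] by blast
    \<comment> \<open>An interval around \<open>x\<close> whose two halves contain no point of \<open>B\<close>.\<close>
    define a b where "a = max 0 (x - \<delta>)" and "b = min 1 (x + \<delta>)"
    have ab: "0 \<le> a" "b \<le> 1" "{a<..<x} \<inter> B = {}" "{x<..<b} \<inter> B = {}"
      using \<delta> by (fastforce simp: a_def b_def dist_real_def)+
    show ?thesis
    proof (cases "x \<in> dyadics")
      case False
      then have x: "0 < x" "x < 1" using True zero_one_dyadics by (auto simp: less_le)
      then have "a < x" "x < b" using \<delta> by (auto simp: a_def b_def)
      moreover have "x \<notin> B" using False B(2) by blast
      then have "{a<..<b} \<inter> B = {}" using ab(3,4) by (fastforce simp: less_le)
      ultimately obtain \<alpha> where \<alpha>: "\<alpha> \<in> dyadic_affine" "\<forall>x\<in>{a..b}. f x = \<alpha> x"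
        using germ[of a b] ab by auto
      have "\<forall>\<^sub>F y in nhds x. y \<in> {a<..<b}"
        using \<open>a < x\<close> \<open>x < b\<close> by (intro eventually_nhds_in_open) auto
      then have "\<forall>\<^sub>F y in nhds x. extend_id f y = \<alpha> y"
        by eventually_elim (use \<alpha>(2) ab in \<open>auto simp: extend_id_def\<close>)
      then show ?thesis using PL_at_if_affine_near \<alpha>(1) by blast
    next
      case dy: True
      have "\<exists>\<alpha>\<in>dyadic_affine. extend_id f x = \<alpha> x \<and> (\<forall>\<^sub>F y in at_left x. extend_id f y = \<alpha> y)"
      proof (cases "x = 0")
        case True
        have "\<forall>\<^sub>F y in at_left x. extend_id f y = y"
          by (auto simp: eventually_at_filter extend_id_def True)
        then show ?thesis using dyadic_affine_id f0 True
          by (intro bexI[of _ "\<lambda>x. x"]) (auto simp: extend_id_def)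
      next
        case False
        then have "a < x" using \<delta> True by (auto simp: a_def)
        then obtain \<alpha> where \<alpha>: "\<alpha> \<in> dyadic_affine" "\<forall>x\<in>{a..x}. f x = \<alpha> x"
          using germ[of a x] ab True by auto
        have "\<forall>\<^sub>F y in at_left x. y \<in> {a<..<x}" using \<open>a < x\<close> by (rule eventually_at_left_real)
        then have "\<forall>\<^sub>F y in at_left x. extend_id f y = \<alpha> y"
          by eventually_elim (use \<alpha>(2) ab True in \<open>auto simp: extend_id_def\<close>)
        moreover have "extend_id f x = \<alpha> x" using \<alpha>(2) True \<open>a < x\<close> by (simp add: extend_id_def)
        ultimately show ?thesis using \<alpha>(1) by blast
      qed
      moreover have "\<exists>\<alpha>\<in>dyadic_affine. extend_id f x = \<alpha> x \<and> (\<forall>\<^sub>F y in at_right x. extend_id f y = \<alpha> y)"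
      proof (cases "x = 1")
        case True
        have "\<forall>\<^sub>F y in at_right x. extend_id f y = y"
          by (auto simp: eventually_at_filter extend_id_def True)
        then show ?thesis using dyadic_affine_id f1 True
          by (intro bexI[of _ "\<lambda>x. x"]) (auto simp: extend_id_def)
      next
        case False
        then have "x < b" using \<delta> True by (auto simp: b_def)
        then obtain \<alpha> where \<alpha>: "\<alpha> \<in> dyadic_affine" "\<forall>x\<in>{x..b}. f x = \<alpha> x"
          using germ[of x b] ab True by auto
        have "\<forall>\<^sub>F y in at_right x. y \<in> {x<..<b}" using \<open>x < b\<close> by (rule eventually_at_right_real)
        then have "\<forall>\<^sub>F y in at_right x. extend_id f y = \<alpha> y"
          by eventually_elim (use \<alpha>(2) ab True in \<open>auto simp: extend_id_def\<close>)
        moreover have "extend_id f x = \<alpha> x" using \<alpha>(2) True \<open>x < b\<close> by (simp add: extend_id_def)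
        ultimately show ?thesis using \<alpha>(1) by blast
      qed
      ultimately show ?thesis using dy PL_atI by meson
    qed
  qed
  then show "PL_homeo (extend_id f)" using bij PL_homeo_def by blast
qed

text \<open>The points where \<open>g\<close> is not locally affine cannot accumulate, since \<open>g\<close> is affine on both sides
of any limit point; compactness does the rest.\<close>

lemma PL_homeo_finite_breaks:
  assumes "\<And>x. PL_at g x"
  shows "finite {x \<in> {0..1}. \<not> (\<exists>\<alpha>\<in>dyadic_affine. \<forall>\<^sub>F y in nhds x. g y = \<alpha> y)}" (is "finite ?B")
proof (rule ccontr)
  assume "infinite ?B"
  then obtain x where x: "x islimpt ?B"
    using compact_eq_Bolzano_Weierstrass[THEN iffD1, OF compact_Icc[of 0 "1::real"]]
    by (metis (no_types, lifting) mem_Collect_eq subsetI)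
  obtain \<alpha> \<beta> where a: "\<alpha> \<in> dyadic_affine" "\<beta> \<in> dyadic_affine"
    "\<forall>\<^sub>F y in at_left x. g y = \<alpha> y" "\<forall>\<^sub>F y in at_right x. g y = \<beta> y"
    using PL_atE[OF assms[of x]] by metis
  obtain l where l: "l < x" "\<And>y. l < y \<Longrightarrow> y < x \<Longrightarrow> g y = \<alpha> y"
    using a(3) eventually_at_left[of "x - 1" x] by auto
  obtain r where r: "x < r" "\<And>y. x < y \<Longrightarrow> y < r \<Longrightarrow> g y = \<beta> y"
    using a(4) eventually_at_right[of x "x + 1"] by auto
  have nb: "y \<notin> ?B" if y: "y \<in> {l<..<x} \<or> y \<in> {x<..<r}" for y
  proof -
    have "\<exists>\<alpha>\<in>dyadic_affine. \<forall>\<^sub>F z in nhds y. g z = \<alpha> z"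
      using y
    proof
      assume "y \<in> {l<..<x}"
      then have "\<forall>\<^sub>F z in nhds y. z \<in> {l<..<x}" by (intro eventually_nhds_in_open) auto
      then have "\<forall>\<^sub>F z in nhds y. g z = \<alpha> z" by eventually_elim (use l in auto)
      then show ?thesis using a(1) by blast
    next
      assume "y \<in> {x<..<r}"
      then have "\<forall>\<^sub>F z in nhds y. z \<in> {x<..<r}" by (intro eventually_nhds_in_open) auto
      then have "\<forall>\<^sub>F z in nhds y. g z = \<beta> z" by eventually_elim (use r in auto)
      then show ?thesis using a(2) by blast
    qed
    then show ?thesis by blast
  qed
  have "\<forall>\<^sub>F y in at_left x. y \<in> {l<..<x}" "\<forall>\<^sub>F y in at_right x. y \<in> {x<..<r}"
    using eventually_at_left_real[OF l(1)] eventually_at_right_real[OF r(1)] .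
  then have "\<forall>\<^sub>F y in at_left x. y \<notin> ?B" "\<forall>\<^sub>F y in at_right x. y \<notin> ?B"
    using nb by (auto elim!: eventually_mono)
  then have "\<forall>\<^sub>F y in at x. y \<notin> ?B" by (simp add: eventually_at_split)
  then show False using x by (simp add: islimpt_iff_eventually)
qed

text \<open>Slope and intercept are locally constant on a connected set. They are expressed by the
derivative in order to be functions of the point.\<close>

lemma affine_between_breaks:
  assumes cont: "continuous_on {a..b} g" and ab: "a < b"
    and loc: "\<And>x. x \<in> {a<..<b} \<Longrightarrow> \<exists>\<alpha>\<in>dyadic_affine. \<forall>\<^sub>F y in nhds x. g y = \<alpha> y"
  shows "\<exists>(k::int) c. \<forall>x\<in>{a..b}. g x = 2 powi k * x + c"
proof -
  define h where "h x = (deriv g x, g x - deriv g x * x)" for x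
  have val: "h x = (2 powi k, c)" if "\<forall>\<^sub>F y in nhds x. g y = 2 powi k * y + c" for x k c
  proof -
    have "deriv g x = deriv (\<lambda>y. 2 powi k * y + c) x" using that by (intro deriv_cong_ev) auto
    also have "\<dots> = 2 powi k" by (rule DERIV_imp_deriv) (auto intro!: derivative_eq_intros)
    finally show ?thesis using eventually_nhds_x_imp_x[OF that] by (simp add: h_def)
  qed
  have near: "\<exists>k c. \<forall>\<^sub>F y in nhds x. g y = 2 powi k * y + c" if "x \<in> {a<..<b}" for x
    using loc[OF that] by (auto elim!: dyadic_affineE)
  have const: "h x = h y" if xy: "x \<in> {a<..<b}" "y \<in> {a<..<b}" for x y
  proof (rule connected_local_const[OF _ xy])
    show "\<forall>x\<in>{a<..<b}. \<forall>\<^sub>F y in at x within {a<..<b}. h x = h y"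
    proof
      fix x assume "x \<in> {a<..<b}"
      then obtain k c where kc: "\<forall>\<^sub>F y in nhds x. g y = 2 powi k * y + c" using near by blast
      then have "\<forall>\<^sub>F z in nhds x. \<forall>\<^sub>F y in nhds z. g y = 2 powi k * y + c"
        by (simp add: eventually_eventually)
      then have "\<forall>\<^sub>F z in nhds x. h x = h z" by eventually_elim (simp add: val val[OF kc])
      then show "\<forall>\<^sub>F y in at x within {a<..<b}. h x = h y"
        by (simp add: eventually_at_filter eventually_mono)
    qed
  qed simp
  define p where "p = (a + b) / 2"
  have p: "p \<in> {a<..<b}" using ab by (simp add: p_def)
  obtain k c where kc: "\<forall>\<^sub>F y in nhds p. g y = 2 powi k * y + c" using near[OF p] by blast
  have open_aff: "g x - 2 powi k * x = c" if x: "x \<in> {a<..<b}" for x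
    using const[OF x p] val[OF kc] by (auto simp: h_def)
  have "g x - 2 powi k * x = c" if "x \<in> {a..b}" for x
  proof (rule continuous_constant_on_closure[of "{a<..<b}" "\<lambda>x. g x - 2 powi k * x"])
    show "continuous_on (closure {a<..<b}) (\<lambda>x. g x - 2 powi k * x)"
      using cont ab by (simp add: continuous_on_diff continuous_on_mult_left)
  qed (use open_aff that ab in auto)
  then show ?thesis by (intro exI[of _ k] exI[of _ c]) (auto simp: algebra_simps)
qed

text \<open>The break points form a finite set by compactness, and they are dyadic because the two germs
agree elsewhere.\<close>

lemma thompson_F_memI:
  assumes e: "f \<in> extensional {0..1}" and P: "PL_homeo (extend_id f)"
  shows "f \<in> carrier thompson_F"
proof -
  define g where "g = extend_id f"
  have g: "increasing_bij g" "\<And>x. PL_at g x" using P by (auto simp: g_def PL_homeo_def)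
  have gf: "g x = f x" if "x \<in> {0..1}" for x using that by (simp add: g_def extend_id_def)
  have out: "g x = x" if "x \<notin> {0..1}" for x using that by (auto simp: g_def extend_id_def)
  have img: "f ` {0..1} = {0..1}"
  proof (intro equalityI subsetI)
    fix y assume "y \<in> f ` {0..1}"
    then obtain x where x: "x \<in> {0..1}" "y = g x" using gf by auto
    show "y \<in> {0..1}"
    proof (rule ccontr)
      assume "y \<notin> {0..1}"
      then have "g y = y" "g y = g x" "y \<noteq> x" using out x by auto
      then show False using increasing_bij_inj[OF g(1)] by (auto dest: injD)
    qed
  next
    fix y :: real assume y: "y \<in> {0..1}"
    obtain x where x: "g x = y" using increasing_bij_f_inv[OF g(1)] by blast
    then have "x \<in> {0..1}" using out[of x] y by fastforce
    then show "y \<in> f ` {0..1}" using x gf by force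
  qed
  have mono: "strict_mono_on {0..1} f"
    using gf increasing_bij_less_iff[OF g(1)] by (auto intro!: strict_mono_onI simp flip: gf)
  then have inj: "inj_on f {0..1}" by (rule strict_mono_on_imp_inj_on)
  have contg: "continuous_on S g" for S
    using increasing_bij_isCont[OF g(1)] by (simp add: continuous_at_imp_continuous_on)
  have cont: "continuous_on {0..1} f"
    using contg[of "{0..1}"] gf continuous_on_cong[of "{0..1}" "{0..1}" g f] by blast
  have homeo: "homeomorphism {0..1} {0..1} f (inv_into {0..1} f)"
  proof -
    obtain h where h: "homeomorphism {0..1} {0..1} f h"
      using homeomorphism_compact[OF compact_Icc cont img inj] by blast
    have "inv_into {0..1} f y = h y" if "y \<in> {0..1}" for y
      using that h inj by (intro inv_into_f_eq) (auto simp: homeomorphism_def)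
    then show ?thesis using homeomorphism_cong[OF h refl refl] by blast
  qed
  define B where "B = {x \<in> {0..1}. \<not> (\<exists>\<alpha>\<in>dyadic_affine. \<forall>\<^sub>F y in nhds x. g y = \<alpha> y)}"
  have B: "finite B" unfolding B_def using PL_homeo_finite_breaks g(2) by blast
  have B': "B \<subseteq> dyadics" unfolding B_def using affine_near_if_PL_at[OF g(2)] by blast
  have seg: "\<exists>(k::int) c. \<forall>x\<in>{a..b}. f x = 2 powi k * x + c"
    if ab: "0 \<le> a" "a < b" "b \<le> 1" "{a<..<b} \<inter> B = {}" for a b
  proof -
    have "\<exists>\<alpha>\<in>dyadic_affine. \<forall>\<^sub>F y in nhds x. g y = \<alpha> y" if "x \<in> {a<..<b}" for x
      using that ab unfolding B_def by fastforce
    then obtain k c where "\<forall>x\<in>{a..b}. g x = 2 powi k * x + c"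
      using affine_between_breaks[OF contg ab(2)] by metis
    then show ?thesis using gf ab by (intro exI[of _ k] exI[of _ c]) auto
  qed
  have "dyadic_PL f" unfolding dyadic_PL_def
    by (intro exI[of _ B] conjI allI impI B B' seg) auto
  then show ?thesis using e mono homeo inj img by (simp add: thompson_F_def Bij_def bij_betw_def)
qed

section \<open>Dilations about a point\<close>

definition dilation :: "real \<Rightarrow> int \<Rightarrow> real \<Rightarrow> real" where
  "dilation \<gamma> k x = \<gamma> + 2 powi k * (x - \<gamma>)"

lemma dilation_fixes [simp]: "dilation \<gamma> k \<gamma> = \<gamma>"
  by (simp add: dilation_def)

lemma dilation_0 [simp]: "dilation \<gamma> 0 x = x"
  by (simp add: dilation_def)

lemma dilation_dilation: "dilation \<gamma> k (dilation \<gamma> l x) = dilation \<gamma> (k + l) x"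
  by (simp add: dilation_def power_int_add)

text \<open>The dilations that occur as germs of elements of \<open>F\<close> at \<open>\<gamma>\<close>. For every \<open>\<gamma>\<close> their exponents form a
group.\<close>

definition dilation_exps :: "real \<Rightarrow> int set" where
  "dilation_exps \<gamma> = {k. dilation \<gamma> k \<in> dyadic_affine}"

lemma dilation_exps_iff: "k \<in> dilation_exps \<gamma> \<longleftrightarrow> (2 powi k - 1) * \<gamma> \<in> dyadics"
proof -
  have eq: "dilation \<gamma> k = (\<lambda>x. 2 powi k * x + - ((2 powi k - 1) * \<gamma>))"
    by (auto simp: dilation_def algebra_simps)
  show ?thesis
  proof
    assume "k \<in> dilation_exps \<gamma>"
    then obtain l c where c: "c \<in> dyadics" "dilation \<gamma> k = (\<lambda>x. 2 powi l * x + c)"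
      unfolding dilation_exps_def by (auto elim: dyadic_affineE)
    have "- ((2 powi k - 1) * \<gamma>) = c" using fun_cong[OF c(2), of 0] eq by simp
    then show "(2 powi k - 1) * \<gamma> \<in> dyadics" using dyadics_minus[OF c(1)] by (metis minus_minus)
  next
    assume "(2 powi k - 1) * \<gamma> \<in> dyadics"
    then show "k \<in> dilation_exps \<gamma>"
      unfolding dilation_exps_def mem_Collect_eq eq by (intro dyadic_affineI dyadics_minus)
  qed
qed

lemma dyadic_affine_fixing:
  assumes "\<alpha> \<in> dyadic_affine" "\<alpha> \<gamma> = \<gamma>"
  obtains k where "k \<in> dilation_exps \<gamma>" "\<alpha> = dilation \<gamma> k"
proof -
  obtain k c where kc: "\<alpha> = (\<lambda>x. 2 powi k * x + c)" using assms(1) by (rule dyadic_affineE)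
  then have "\<alpha> = dilation \<gamma> k" using assms(2) by (auto simp: dilation_def algebra_simps)
  then show thesis using that assms(1) by (simp add: dilation_exps_def)
qed

lemma dilation_exps_add:
  assumes "k \<in> dilation_exps \<gamma>" "l \<in> dilation_exps \<gamma>" shows "k + l \<in> dilation_exps \<gamma>"
proof -
  have "dilation \<gamma> (k + l) = dilation \<gamma> k \<circ> dilation \<gamma> l"
    by (auto simp: dilation_dilation)
  then show ?thesis using assms dyadic_affine_comp by (simp add: dilation_exps_def)
qed

lemma dilation_exps_minus: assumes "k \<in> dilation_exps \<gamma>" shows "- k \<in> dilation_exps \<gamma>"
proof -
  have "(2 powi (- k) - 1) * \<gamma> = - (2 powi (- k) * ((2 powi k - 1) * \<gamma>))"
    by (simp add: power_int_minus field_simps)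
  then show ?thesis using assms by (simp add: dilation_exps_iff dyadics_minus)
qed

lemma dilation_exps_mult: assumes "k \<in> dilation_exps \<gamma>" shows "k * m \<in> dilation_exps \<gamma>"
proof -
  have nat: "k * int n \<in> dilation_exps \<gamma>" for n
  proof (induction n)
    case 0
    show ?case by (simp add: dilation_exps_iff)
  next
    case (Suc n)
    then show ?case using dilation_exps_add[OF assms Suc] by (simp add: algebra_simps)
  qed
  show ?thesis
  proof (cases "m \<ge> 0")
    case True
    then show ?thesis using nat[of "nat m"] by simp
  next
    case False
    then show ?thesis using dilation_exps_minus[OF nat[of "nat (- m)"]] by simp
  qed
qed

text \<open>For \<open>k \<noteq> 0\<close> the number \<open>(2\<^sup>k - 1) \<gamma>\<close> is irrational, hence not dyadic.\<close>

lemma dilation_exps_irrational: assumes "\<gamma> \<notin> \<rat>" shows "dilation_exps \<gamma> = {0}"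
proof -
  have "k = 0" if "k \<in> dilation_exps \<gamma>" for k
  proof (rule ccontr)
    assume "k \<noteq> 0"
    then have ne: "2 powi k - 1 \<noteq> (0::real)"
      using power_int_strict_increasing[of k 0 "2::real"] power_int_strict_increasing[of 0 k "2::real"]
      by (cases "k < 0") auto
    have dr: "x \<in> \<rat>" if "x \<in> dyadics" for x
      using that unfolding dyadics_def by auto
    have "(2 powi k - 1) * \<gamma> \<in> \<rat>" "2 powi k - 1 \<in> (\<rat>::real set)"
      using that dr[of "(2 powi k - 1) * \<gamma>"] dr[of "2 powi k - 1"]
      by (auto simp: dilation_exps_iff dyadics_diff)
    then have "(2 powi k - 1) * \<gamma> / (2 powi k - 1) \<in> \<rat>" by (rule Rats_divide)
    then show False using ne assms by simp
  qed
  then show ?thesis by (auto simp: dilation_exps_iff)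
qed

text \<open>Write \<open>\<gamma> = p / q\<close>. By the pigeonhole principle two of the numbers \<open>2\<^sup>i p\<close> with \<open>i \<le> q\<close> agree
modulo \<open>q\<close>, so that \<open>2\<^sup>i (2\<^sup>j\<^sup>-\<^sup>i - 1) \<gamma>\<close> is an integer for some \<open>i < j\<close>.\<close>

lemma dilation_exps_rational_positive:
  assumes "\<gamma> \<in> \<rat>" obtains k where "k \<in> dilation_exps \<gamma>" "k > 0"
proof -
  obtain p q :: int where q: "q > 0" and \<gamma>: "\<gamma> = of_int p / of_int q"
    using assms by (metis Rats_cases')
  define r where "r i = (2 ^ i * p) mod q" for i :: nat
  have "r ` {0..nat q} \<subseteq> {0..<q}" using q by (auto simp: r_def)
  then have "card (r ` {0..nat q}) \<le> card {0..<q}" by (intro card_mono) auto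
  also have "\<dots> < card {0..nat q}" using q by simp
  finally have "\<not> inj_on r {0..nat q}" by (rule pigeonhole)
  then obtain i' j' where "r i' = r j'" "i' \<noteq> j'" unfolding inj_on_def by blast
  then obtain i j where ij: "r i = r j" "i < j" by (metis linorder_neqE_nat)
  then have "q dvd 2 ^ j * p - 2 ^ i * p" by (metis mod_eq_dvd_iff r_def)
  then obtain t where t: "2 ^ j * p - 2 ^ i * p = q * t" by blast
  have "(2::real) ^ j = 2 ^ i * 2 ^ (j - i)" using ij(2) by (simp flip: power_add)
  moreover have "(2 ^ j - 2 ^ i) * \<gamma> = of_int t"
    using arg_cong[OF t, of real_of_int] q by (simp add: \<gamma> field_simps)
  ultimately have "(2 ^ (j - i) - 1) * \<gamma> = of_int t / 2 ^ i" by (simp add: field_simps)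
  then have "(2 powi int (j - i) - 1) * \<gamma> \<in> dyadics" using dyadicsI by simp
  then show thesis using that[of "int (j - i)"] ij(2) by (simp add: dilation_exps_iff)
qed

text \<open>A nonzero subgroup of the integers is generated by its least positive element.\<close>

lemma dilation_exps_rational:
  assumes "\<gamma> \<in> \<rat>" obtains d where "d > 0" "dilation_exps \<gamma> = range (\<lambda>m. d * m)"
proof -
  obtain k where k: "k \<in> dilation_exps \<gamma>" "k > 0" using dilation_exps_rational_positive[OF assms] .
  define d where "d = (LEAST n. n > 0 \<and> int n \<in> dilation_exps \<gamma>)"
  have ex: "nat k > 0 \<and> int (nat k) \<in> dilation_exps \<gamma>" using k by simp
  have d: "d > 0" "int d \<in> dilation_exps \<gamma>"
    using LeastI[of "\<lambda>n. n > 0 \<and> int n \<in> dilation_exps \<gamma>", OF ex] by (auto simp: d_def)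
  have "int d dvd l" if l: "l \<in> dilation_exps \<gamma>" for l
  proof (rule ccontr)
    assume "\<not> int d dvd l"
    then have "l mod int d \<noteq> 0" by (simp add: dvd_eq_mod_eq_0)
    then have pos: "l mod int d > 0" using d(1) pos_mod_sign[of "int d" l] by linarith
    moreover have "l mod int d = l + - (int d * (l div int d))" by (simp add: minus_mult_div_eq_mod)
    then have "l mod int d \<in> dilation_exps \<gamma>"
      using l d(2) by (metis dilation_exps_add dilation_exps_minus dilation_exps_mult)
    ultimately have "d \<le> nat (l mod int d)" using pos unfolding d_def by (intro Least_le) simp
    moreover have "l mod int d < int d" using d(1) by simp
    ultimately show False using pos by linarith
  qed
  then have "dilation_exps \<gamma> = range (\<lambda>m. int d * m)"
    using dilation_exps_mult[OF d(2)] unfolding dvd_def by auto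
  then show thesis using that[of "int d"] d(1) by simp
qed

section \<open>Maps that conjugate germs to germs\<close>

text \<open>Conjugation by \<open>\<phi>\<close> takes germs of dyadic dilations at \<open>\<gamma>\<close> to such germs at \<open>\<phi> \<gamma>\<close>, and its inverse
takes them back. Only the germ of \<open>\<phi>\<close> matters, so \<open>\<phi>\<close> can be altered away from \<open>\<gamma>\<close>.\<close>

definition intertwines :: "(real \<Rightarrow> real) \<Rightarrow> real \<Rightarrow> bool" where
  "intertwines \<phi> \<gamma> \<longleftrightarrow>
     (\<forall>k\<in>dilation_exps \<gamma>. \<exists>l\<in>dilation_exps (\<phi> \<gamma>).
        \<forall>\<^sub>F x in nhds \<gamma>. \<phi> (dilation \<gamma> k x) = dilation (\<phi> \<gamma>) l (\<phi> x)) \<and>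
     (\<forall>l\<in>dilation_exps (\<phi> \<gamma>). \<exists>k\<in>dilation_exps \<gamma>.
        \<forall>\<^sub>F x in nhds \<gamma>. \<phi> (dilation \<gamma> k x) = dilation (\<phi> \<gamma>) l (\<phi> x))"

text \<open>What is asked of \<open>\<phi>\<close> at a point of \<open>U\<close>: enough for \<open>PL_at_conj_regular\<close>, and invariant
under passing to the inverse. For the latter \<open>\<phi> x\<close>, too, must not be dyadic.\<close>

definition regular_at :: "(real \<Rightarrow> real) \<Rightarrow> real \<Rightarrow> bool" where
  "regular_at \<phi> x \<longleftrightarrow> PL_at \<phi> x \<or> (x \<notin> dyadics \<and> \<phi> x \<notin> dyadics \<and> intertwines \<phi> x)"

lemma dilation_filterlim:
  assumes "k \<in> dilation_exps \<gamma>" shows "filterlim (dilation \<gamma> k) (nhds \<gamma>) (nhds \<gamma>)"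
  using increasing_bij_filterlim(1)[OF increasing_bij_affine, of "dilation \<gamma> k" \<gamma>] assms
  by (simp add: dilation_exps_def)

lemma regular_at_cong:
  assumes eq: "\<forall>\<^sub>F y in nhds x. f y = g y" and f: "regular_at f x"
  shows "regular_at g x"
proof (cases "PL_at f x")
  case True
  then show ?thesis using PL_at_cong[OF eq] by (simp add: regular_at_def)
next
  case False
  have x: "f x = g x" using eventually_nhds_x_imp_x[OF eq] .
  have "\<forall>\<^sub>F y in nhds x. g (dilation x k y) = dilation (g x) l (g y)"
    if k: "k \<in> dilation_exps x" and e: "\<forall>\<^sub>F y in nhds x. f (dilation x k y) = dilation (f x) l (f y)" for k l
  proof -
    have "\<forall>\<^sub>F y in nhds x. f (dilation x k y) = g (dilation x k y)"
      by (rule eventually_compose_filterlim[OF eq dilation_filterlim[OF k]])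
    with eq e show ?thesis by eventually_elim (simp add: x)
  qed
  then have "intertwines f x \<Longrightarrow> intertwines g x"
    unfolding intertwines_def x by meson
  then show ?thesis using False f x by (simp add: regular_at_def)
qed

lemma regular_at_rinv:
  assumes \<phi>: "increasing_bij \<phi>" and r: "regular_at \<phi> x"
  shows "regular_at (rinv \<phi>) (\<phi> x)"
proof (cases "PL_at \<phi> x")
  case True
  then show ?thesis using PL_at_inv[OF \<phi>] by (simp add: regular_at_def)
next
  case False
  note inv = increasing_bij_inv_f[OF \<phi>] increasing_bij_f_inv[OF \<phi>]
  have e: "\<forall>\<^sub>F y in nhds (\<phi> x). rinv \<phi> (dilation (\<phi> x) l y) = dilation x k (rinv \<phi> y)"
    if "\<forall>\<^sub>F z in nhds x. \<phi> (dilation x k z) = dilation (\<phi> x) l (\<phi> z)" for k l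
  proof -
    have "\<forall>\<^sub>F y in nhds (\<phi> x). \<phi> (dilation x k (rinv \<phi> y)) = dilation (\<phi> x) l (\<phi> (rinv \<phi> y))"
      using eventually_compose_filterlim[OF that, of "rinv \<phi>" "nhds (\<phi> x)"]
        increasing_bij_filterlim(1)[OF increasing_bij_inv[OF \<phi>], of "\<phi> x"] by (simp add: inv)
    then show ?thesis
    proof eventually_elim
      case (elim y)
      then have "rinv \<phi> (\<phi> (dilation x k (rinv \<phi> y))) = rinv \<phi> (dilation (\<phi> x) l y)" by (simp add: inv)
      then show ?case by (simp add: inv)
    qed
  qed
  have "intertwines \<phi> x" using False r by (simp add: regular_at_def)
  then have "intertwines (rinv \<phi>) (\<phi> x)"
    unfolding intertwines_def inv using e by meson
  then show ?thesis using False r by (simp add: regular_at_def inv)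
qed

text \<open>If \<open>x\<close> is not dyadic, the germ of \<open>f\<close> at its fixed point \<open>x\<close> is a dilation, which \<open>\<phi>\<close>
intertwines with a dilation at \<open>\<phi> x\<close>.\<close>

lemma PL_at_conj_regular:
  assumes \<phi>: "increasing_bij \<phi>" and r: "regular_at \<phi> x" and f: "PL_homeo f" "f x = x"
  shows "PL_at (\<phi> \<circ> f \<circ> rinv \<phi>) (\<phi> x)"
proof (cases "PL_at \<phi> x")
  case True
  note inv = increasing_bij_inv_f[OF \<phi>] increasing_bij_f_inv[OF \<phi>]
  have "PL_at (\<phi> \<circ> f) x" using f True PL_at_comp by (simp add: PL_homeo_def)
  then show ?thesis
    using PL_at_comp[OF increasing_bij_inv[OF \<phi>] PL_at_inv[OF \<phi> True], of "\<phi> \<circ> f"] by (simp add: inv)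
next
  case False
  have x: "x \<notin> dyadics" "intertwines \<phi> x" using False r by (auto simp: regular_at_def)
  obtain \<alpha> where \<alpha>: "\<alpha> \<in> dyadic_affine" "\<forall>\<^sub>F y in nhds x. f y = \<alpha> y"
    using affine_near_if_PL_at x(1) f(1) unfolding PL_homeo_def by blast
  have "\<alpha> x = x" using eventually_nhds_x_imp_x[OF \<alpha>(2)] f(2) by simp
  then obtain k where k: "k \<in> dilation_exps x" "\<alpha> = dilation x k"
    using dyadic_affine_fixing[OF \<alpha>(1)] by metis
  obtain l where l: "l \<in> dilation_exps (\<phi> x)"
    "\<forall>\<^sub>F y in nhds x. \<phi> (dilation x k y) = dilation (\<phi> x) l (\<phi> y)"
    using x(2) k(1) unfolding intertwines_def by meson
  have "\<forall>\<^sub>F y in nhds x. \<phi> (f y) = dilation (\<phi> x) l (\<phi> y)"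
    using \<alpha>(2) l(2) by eventually_elim (simp add: k(2))
  then have "\<forall>\<^sub>F y in nhds (\<phi> x). (\<phi> \<circ> f \<circ> rinv \<phi>) y = dilation (\<phi> x) l y"
    using eventually_compose_filterlim[of _ "nhds x" "rinv \<phi>" "nhds (\<phi> x)"]
      increasing_bij_filterlim(1)[OF increasing_bij_inv[OF \<phi>], of "\<phi> x"] by (fastforce simp: increasing_bij_inv_f[OF \<phi>] increasing_bij_f_inv[OF \<phi>])
  then show ?thesis using PL_at_if_affine_near l(1) by (simp add: dilation_exps_def)
qed

text \<open>At a point off \<open>U\<close> the three factors are piecewise linear one after the other, because \<open>f\<close> does not
move that point into \<open>U\<close>.\<close>

lemma PL_homeo_conj:
  assumes \<phi>: "increasing_bij \<phi>" and off: "\<And>x. x \<notin> U \<Longrightarrow> PL_at \<phi> x"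
    and on: "\<And>x. x \<in> U \<Longrightarrow> regular_at \<phi> x"
    and f: "PL_homeo f" "\<And>x. x \<in> U \<Longrightarrow> f x = x"
  shows "PL_homeo (\<phi> \<circ> f \<circ> rinv \<phi>)"
proof -
  note inv = increasing_bij_inv_f[OF \<phi>] increasing_bij_f_inv[OF \<phi>]
  have fb: "increasing_bij f" "\<And>x. PL_at f x" using f(1) by (auto simp: PL_homeo_def)
  have "PL_at (\<phi> \<circ> f \<circ> rinv \<phi>) (\<phi> x)" for x
  proof (cases "x \<in> U")
    case True
    then show ?thesis using PL_at_conj_regular[OF \<phi> on f(1)] f(2) by blast
  next
    case False
    then have "f x \<notin> U" using f(2)[of "f x"] injD[OF increasing_bij_inj[OF fb(1)], of "f x" x] by auto
    then have "PL_at (\<phi> \<circ> f) x" using PL_at_comp[OF fb] off by blast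
    then show ?thesis
      using PL_at_comp[OF increasing_bij_inv[OF \<phi>] PL_at_inv[OF \<phi> off[OF False]], of "\<phi> \<circ> f"]
      by (simp add: inv)
  qed
  then have "PL_at (\<phi> \<circ> f \<circ> rinv \<phi>) y" for y using inv(2)[of y] by metis
  moreover have "increasing_bij (\<phi> \<circ> f \<circ> rinv \<phi>)"
    using increasing_bij_comp[OF increasing_bij_inv[OF \<phi>] increasing_bij_comp[OF fb(1) \<phi>]] by simp
  ultimately show ?thesis by (simp add: PL_homeo_def)
qed

section \<open>Conjugation isomorphisms\<close>

lemma extend_id_inject:
  assumes "f \<in> extensional {0..1}" "g \<in> extensional {0..1}" "extend_id f = extend_id g"
  shows "f = g"
proof (rule extensionalityI[OF assms(1,2)])
  fix x :: real assume "x \<in> {0..1}"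
  then show "f x = g x" using fun_cong[OF assms(3), of x] by (simp add: extend_id_def)
qed

lemma H_iff:
  assumes "U \<subseteq> {0<..<1}"
  shows "f \<in> H U \<longleftrightarrow> f \<in> extensional {0..1} \<and> PL_homeo (extend_id f) \<and> (\<forall>x\<in>U. extend_id f x = x)"
proof -
  have "extend_id f x = f x" if "x \<in> U" for x using assms that by (force simp: extend_id_def)
  then show ?thesis using thompson_F_memD thompson_F_memI unfolding H_def by auto
qed

lemma mult_thompson_F:
  "f \<in> carrier thompson_F \<Longrightarrow> g \<in> carrier thompson_F \<Longrightarrow> f \<otimes>\<^bsub>thompson_F\<^esub> g = compose {0..1} f g"
  by (simp add: thompson_F_def BijGroup_def)

lemma thompson_F_image: "f \<in> carrier thompson_F \<Longrightarrow> x \<in> {0..1} \<Longrightarrow> f x \<in> {0..1}"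
  by (auto simp: thompson_F_def Bij_def dest!: bij_betwE)

lemma extend_id_compose:
  assumes "g \<in> carrier thompson_F"
  shows "extend_id (compose {0..1} f g) = extend_id f \<circ> extend_id g"
  using thompson_F_image[OF assms] by (auto simp: extend_id_def compose_def)

definition conj_by :: "(real \<Rightarrow> real) \<Rightarrow> (real \<Rightarrow> real) \<Rightarrow> real \<Rightarrow> real" where
  "conj_by \<phi> f = restrict (\<phi> \<circ> extend_id f \<circ> rinv \<phi>) {0..1}"

lemma extend_id_conj_by:
  assumes \<phi>: "increasing_bij \<phi>" "\<phi> 0 = 0" "\<phi> 1 = 1"
  shows "extend_id (conj_by \<phi> f) = \<phi> \<circ> extend_id f \<circ> rinv \<phi>"
proof
  fix x
  note inv = increasing_bij_f_inv[OF \<phi>(1)]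
  show "extend_id (conj_by \<phi> f) x = (\<phi> \<circ> extend_id f \<circ> rinv \<phi>) x"
  proof (cases "x \<in> {0..1}")
    case False
    then have "rinv \<phi> x \<notin> {0..1}"
      using increasing_bij_le_iff[OF \<phi>(1), of 0 "rinv \<phi> x"] increasing_bij_le_iff[OF \<phi>(1), of "rinv \<phi> x" 1]
      by (simp add: inv \<phi>(2,3))
    then have "extend_id f (rinv \<phi> x) = rinv \<phi> x" unfolding extend_id_def by (simp only: if_False)
    moreover have "extend_id (conj_by \<phi> f) x = x" using False unfolding extend_id_def by (simp only: if_False)
    ultimately show ?thesis by (simp add: inv)
  qed (simp add: extend_id_def conj_by_def)
qed

lemma conj_by_H:
  assumes \<phi>: "increasing_bij \<phi>" "\<phi> 0 = 0" "\<phi> 1 = 1" and off: "\<And>x. x \<notin> U \<Longrightarrow> PL_at \<phi> x"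
    and on: "\<And>x. x \<in> U \<Longrightarrow> regular_at \<phi> x" and UV: "\<phi> ` U = V" "U \<subseteq> {0<..<1}" "V \<subseteq> {0<..<1}"
    and f: "f \<in> H U"
  shows "conj_by \<phi> f \<in> H V"
proof -
  have f': "PL_homeo (extend_id f)" "\<And>x. x \<in> U \<Longrightarrow> extend_id f x = x"
    using f by (auto simp: H_iff[OF UV(2)])
  have "PL_homeo (extend_id (conj_by \<phi> f))"
    unfolding extend_id_conj_by[OF \<phi>] using PL_homeo_conj[OF \<phi>(1) off on f'] by blast
  moreover have "extend_id (conj_by \<phi> f) y = y" if y: "y \<in> V" for y
  proof -
    obtain x where "x \<in> U" "y = \<phi> x" using y UV(1) by blast
    then show ?thesis by (simp add: extend_id_conj_by[OF \<phi>] increasing_bij_inv_f[OF \<phi>(1)] f'(2))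
  qed
  ultimately show ?thesis by (simp add: H_iff[OF UV(3)] conj_by_def)
qed

text \<open>The hypotheses on \<open>\<phi>\<close> are symmetric under inversion, so conjugation by the inverse map is the
inverse of conjugation by \<open>\<phi>\<close>.\<close>

lemma H_iso_if_conjugating_map:
  assumes \<phi>: "increasing_bij \<phi>" "\<phi> 0 = 0" "\<phi> 1 = 1" and off: "\<And>x. x \<notin> U \<Longrightarrow> PL_at \<phi> x"
    and on: "\<And>x. x \<in> U \<Longrightarrow> regular_at \<phi> x" and UV: "\<phi> ` U = V" "U \<subseteq> {0<..<1}" "V \<subseteq> {0<..<1}"
  shows "thompson_F\<lparr>carrier := H U\<rparr> \<cong> thompson_F\<lparr>carrier := H V\<rparr>"
proof -
  note inv = increasing_bij_inv_f[OF \<phi>(1)] increasing_bij_f_inv[OF \<phi>(1)]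
  define \<psi> where "\<psi> = rinv \<phi>"
  have \<psi>: "increasing_bij \<psi>" "\<psi> 0 = 0" "\<psi> 1 = 1"
    unfolding \<psi>_def using increasing_bij_inv[OF \<phi>(1)] inv(1)[of 0] inv(1)[of 1] \<phi> by simp_all
  have "bij \<phi>" using \<phi>(1) by (simp add: bij_def increasing_bij_inj increasing_bij_surj)
  then have rr: "rinv \<psi> = \<phi>" unfolding \<psi>_def by (rule inv_inv_eq)
  have off': "PL_at \<psi> y" if "y \<notin> V" for y
    using PL_at_inv[OF \<phi>(1) off[of "\<psi> y"]] that UV(1) inv(2)[of y] unfolding \<psi>_def by (metis imageI)
  have on': "regular_at \<psi> y" if y: "y \<in> V" for y
  proof -
    obtain x where "x \<in> U" "y = \<phi> x" using y UV(1) by blast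
    then show ?thesis using regular_at_rinv[OF \<phi>(1) on] by (simp add: \<psi>_def)
  qed
  have VU: "\<psi> ` V = U" by (simp add: UV(1)[symmetric] image_image \<psi>_def inv)
  have to: "conj_by \<phi> f \<in> H V" if "f \<in> H U" for f
    using conj_by_H[OF \<phi> _ _ UV that] off on by blast
  have back_to: "conj_by \<psi> f \<in> H U" if "f \<in> H V" for f
    using conj_by_H[OF \<psi> _ _ VU UV(3,2) that] off' on' by blast
  have left_inv: "conj_by \<psi> (conj_by \<phi> f) = f" if f: "f \<in> H U" for f
  proof (rule extend_id_inject)
    show "extend_id (conj_by \<psi> (conj_by \<phi> f)) = extend_id f"
      unfolding extend_id_conj_by[OF \<psi>] extend_id_conj_by[OF \<phi>] rr by (auto simp: \<psi>_def inv)
  qed (use f in \<open>auto simp: conj_by_def H_iff[OF UV(2)]\<close>)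
  have right_inv: "conj_by \<phi> (conj_by \<psi> f) = f" if f: "f \<in> H V" for f
  proof (rule extend_id_inject)
    show "extend_id (conj_by \<phi> (conj_by \<psi> f)) = extend_id f"
      unfolding extend_id_conj_by[OF \<psi>] extend_id_conj_by[OF \<phi>] rr by (auto simp: \<psi>_def inv)
  qed (use f in \<open>auto simp: conj_by_def H_iff[OF UV(3)]\<close>)
  have carr: "f \<in> carrier thompson_F" if "f \<in> H W" for f W using that by (simp add: H_def)
  have mult: "conj_by \<phi> (f \<otimes>\<^bsub>thompson_F\<^esub> g) = conj_by \<phi> f \<otimes>\<^bsub>thompson_F\<^esub> conj_by \<phi> g"
    if f: "f \<in> H U" and g: "g \<in> H U" for f g
  proof -
    note c = carr[OF f] carr[OF g] and c' = carr[OF to[OF f]] carr[OF to[OF g]]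
    have "conj_by \<phi> (compose {0..1} f g) = compose {0..1} (conj_by \<phi> f) (conj_by \<phi> g)"
    proof (rule extend_id_inject)
      show "extend_id (conj_by \<phi> (compose {0..1} f g)) = extend_id (compose {0..1} (conj_by \<phi> f) (conj_by \<phi> g))"
        unfolding extend_id_compose[OF c'(2)] extend_id_conj_by[OF \<phi>] extend_id_compose[OF c(2)]
        by (auto simp: inv)
    qed (auto simp: conj_by_def compose_def)
    then show ?thesis using mult_thompson_F[OF c] mult_thompson_F[OF c'] by simp
  qed
  have "bij_betw (conj_by \<phi>) (H U) (H V)"
    by (rule bij_betw_byWitness[where f' = "conj_by \<psi>"]) (use left_inv right_inv to back_to in auto)
  then have "conj_by \<phi> \<in> iso (thompson_F\<lparr>carrier := H U\<rparr>) (thompson_F\<lparr>carrier := H V\<rparr>)"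
    using to mult by (auto simp: iso_def hom_def)
  then show ?thesis by (auto simp: is_iso_def)
qed

section \<open>Maps assembled from infinitely many pieces\<close>

text \<open>A strictly increasing two-sided sequence of dyadic numbers tending to both ends of the open interval
\<open>S\<close>. Membership in \<open>S\<close> is expressed by strict inequalities on both sides, which makes the notion
invariant under \<open>x \<mapsto> - x\<close>; so only ladders above a point have to be constructed.\<close>

definition ladder :: "(int \<Rightarrow> real) \<Rightarrow> real set \<Rightarrow> bool" where
  "ladder a S \<longleftrightarrow> strict_mono a \<and> range a \<subseteq> dyadics \<and> (\<forall>x. x \<in> S \<longleftrightarrow> (\<exists>m n. a m < x \<and> x < a n))"

lemma strict_mono_int_step:
  fixes a :: "int \<Rightarrow> real"
  assumes "\<And>n. a n < a (n + 1)" shows "strict_mono a"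
proof (rule strict_monoI)
  fix m n :: int assume "m < n"
  have "a m < a (m + 1 + int k)" for k
  proof (induction k)
    case 0
    then show ?case using assms by simp
  next
    case (Suc k)
    then show ?case using assms[of "m + 1 + int k"] by (simp add: algebra_simps)
  qed
  from this[of "nat (n - m - 1)"] show "a m < a n" using \<open>m < n\<close> by simp
qed

lemma ladder_rung:
  assumes "ladder a S" "x \<in> S" obtains n where "a n \<le> x" "x < a (n + 1)"
proof -
  obtain m l where m: "a m < x" "x < a l" using assms unfolding ladder_def by blast
  have "strict_mono a" using assms(1) by (simp add: ladder_def)
  then have "m < l" using m by (metis less_trans strict_mono_less)
  then have ex: "x < a (m + int (nat (l - m)))" using m by simp
  define k where "k = (LEAST k. x < a (m + int k))"
  have k: "x < a (m + int k)" unfolding k_def using ex by (rule LeastI)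
  then have "k \<noteq> 0" using m(1) by (cases k) auto
  then have "\<not> x < a (m + int (k - 1))" unfolding k_def by (intro not_less_Least) simp
  then show thesis using that[of "m + int k - 1"] k \<open>k \<noteq> 0\<close> by (simp add: algebra_simps)
qed

lemma ladder_between: assumes "ladder a S" "a m \<le> x" "x \<le> a n" shows "x \<in> S"
proof -
  have "a (m - 1) < a m" "a n < a (n + 1)" using assms by (auto simp: ladder_def strict_mono_less)
  then have "a (m - 1) < x" "x < a (n + 1)" using assms(2,3) by linarith+
  then show ?thesis using assms(1) unfolding ladder_def by blast
qed

lemma ladder_reflect:
  assumes "ladder a S" shows "ladder (\<lambda>n. - a (- n)) {x. - x \<in> S}"
proof -
  have "(\<exists>m n. - a (- m) < x \<and> x < - a (- n)) \<longleftrightarrow> (\<exists>m n. a m < - x \<and> - x < a n)" for x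
  proof
    assume "\<exists>m n. - a (- m) < x \<and> x < - a (- n)"
    then obtain m n where "- a (- m) < x" "x < - a (- n)" by blast
    then show "\<exists>m n. a m < - x \<and> - x < a n" by (intro exI[of _ "- n"] exI[of _ "- m"]) auto
  next
    assume "\<exists>m n. a m < - x \<and> - x < a n"
    then obtain m n where "a m < - x" "- x < a n" by blast
    then show "\<exists>m n. - a (- m) < x \<and> x < - a (- n)" by (intro exI[of _ "- n"] exI[of _ "- m"]) auto
  qed
  then show ?thesis using assms by (auto simp: ladder_def strict_mono_def intro!: dyadics_minus)
qed

lemma ladder_step_PL_homeo:
  assumes "ladder a S" "ladder b T"
  obtains p where "PL_homeo p" "p (a n) = b n" "p (a (n + 1)) = b (n + 1)"
proof (rule PL_homeo_interval[of "a n" "a (n + 1)" "b n" "b (n + 1)"])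
  show "a n < a (n + 1)" "b n < b (n + 1)"
    using assms by (auto simp: ladder_def strict_mono_less)
qed (use assms that in \<open>auto simp: ladder_def\<close>)

definition PL_between :: "real set \<Rightarrow> real set \<Rightarrow> (real \<Rightarrow> real) \<Rightarrow> bool" where
  "PL_between S T f \<longleftrightarrow>
     (\<forall>x\<in>S. \<forall>y\<in>S. x < y \<longrightarrow> f x < f y) \<and> f ` S = T \<and> (\<forall>x\<in>S. PL_at f x)"

text \<open>Maps that agree with two given ladders on consecutive rungs fit together. No break point condition
is violated at a rung, because rungs are dyadic.\<close>

lemma ladder_assemble:
  assumes a: "ladder a S" and b: "ladder b T" and P: "\<And>n. PL_homeo (P n)"
    and ab: "\<And>n. P n (a n) = b n" "\<And>n. P n (a (n + 1)) = b (n + 1)"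
  obtains f where "PL_between S T f" "\<And>n x. a n \<le> x \<Longrightarrow> x \<le> a (n + 1) \<Longrightarrow> f x = P n x"
proof -
  have am: "a m < a n \<longleftrightarrow> m < n" "a m \<le> a n \<longleftrightarrow> m \<le> n" for m n
    using a by (auto simp: ladder_def strict_mono_less strict_mono_less_eq)
  have bm: "b m < b n \<longleftrightarrow> m < n" "b m \<le> b n \<longleftrightarrow> m \<le> n" for m n
    using b by (auto simp: ladder_def strict_mono_less strict_mono_less_eq)
  have Pb: "increasing_bij (P n)" "PL_at (P n) x" for n x using P by (auto simp: PL_homeo_def)
  define rung where "rung x = (THE n. a n \<le> x \<and> x < a (n + 1))" for x
  have rung: "rung x = n" if "a n \<le> x" "x < a (n + 1)" for x n
    unfolding rung_def
  proof (rule the_equality)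
    fix m assume m: "a m \<le> x \<and> x < a (m + 1)"
    have "a m < a (n + 1)" "a n < a (m + 1)" using m that by linarith+
    then show "m = n" using am by auto
  qed (use that in blast)
  define f where "f x = P (rung x) x" for x
  have f_lt: "f x = P n x" if "a n \<le> x" "x < a (n + 1)" for x n
    using rung[OF that] by (simp add: f_def)
  have f: "f x = P n x" if "a n \<le> x" "x \<le> a (n + 1)" for x n
  proof (cases "x = a (n + 1)")
    case True
    then show ?thesis using f_lt[of "n + 1" x] am ab by auto
  qed (use that f_lt in auto)
  have range_f: "b n \<le> f x" "f x < b (n + 1)" if "a n \<le> x" "x < a (n + 1)" for x n
    using that f_lt[OF that] increasing_bij_le_iff[OF Pb(1), of n "a n" x]
      increasing_bij_less_iff[OF Pb(1), of n x "a (n + 1)"] ab by auto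
  have mono: "f x < f y" if xy: "x \<in> S" "y \<in> S" "x < y" for x y
  proof -
    obtain n where n: "a n \<le> x" "x < a (n + 1)" using ladder_rung[OF a xy(1)] .
    obtain m where m: "a m \<le> y" "y < a (m + 1)" using ladder_rung[OF a xy(2)] .
    have "a n < a (m + 1)" using n m xy(3) by linarith
    then have "n \<le> m" using am by auto
    show ?thesis
    proof (cases "n = m")
      case True
      then show ?thesis using f_lt[OF n] f_lt[OF m] xy(3) increasing_bij_less_iff[OF Pb(1)] by simp
    next
      case False
      then have "b (n + 1) \<le> b m" using \<open>n \<le> m\<close> bm by auto
      then show ?thesis using range_f[OF n] range_f[OF m] by linarith
    qed
  qed
  have img: "f ` S = T"
  proof (intro equalityI subsetI)
    fix y assume "y \<in> f ` S"
    then obtain x where x: "x \<in> S" "y = f x" by blast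
    obtain n where n: "a n \<le> x" "x < a (n + 1)" using ladder_rung[OF a x(1)] .
    show "y \<in> T" using ladder_between[OF b, of n y "n + 1"] range_f[OF n] x(2) by simp
  next
    fix y assume "y \<in> T"
    then obtain n where n: "b n \<le> y" "y < b (n + 1)" using ladder_rung[OF b] by metis
    define x where "x = rinv (P n) y"
    have x: "P n x = y" unfolding x_def by (rule increasing_bij_f_inv[OF Pb(1)])
    then have xa: "a n \<le> x" "x < a (n + 1)"
      using n increasing_bij_le_iff[OF Pb(1), of n "a n" x]
      increasing_bij_less_iff[OF Pb(1), of n x "a (n + 1)"] ab by auto
    then have "x \<in> S" using ladder_between[OF a, of n x "n + 1"] by simp
    moreover have "y = f x" using f_lt[OF xa] x by simp
    ultimately show "y \<in> f ` S" by blast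
  qed
  have PL: "PL_at f x" if x: "x \<in> S" for x
  proof -
    obtain n where n: "a n \<le> x" "x < a (n + 1)" using ladder_rung[OF a x] .
    show ?thesis
    proof (cases "x = a n")
      case False
      have "\<forall>\<^sub>F y in nhds x. y \<in> {a n<..<a (n + 1)}"
        using n False by (intro eventually_nhds_in_open) auto
      then have "\<forall>\<^sub>F y in nhds x. P n y = f y" by eventually_elim (simp add: f_lt[of n])
      then show ?thesis using PL_at_cong Pb(2) by blast
    next
      case True
      \<comment> \<open>At a rung the map is the previous piece glued to the next one.\<close>
      have "\<forall>\<^sub>F y in nhds x. y \<in> {a (n - 1)<..<a (n + 1)}"
        using n True am by (intro eventually_nhds_in_open) auto
      then have ev: "\<forall>\<^sub>F y in nhds x. glue (a n) (P (n - 1)) (P n) y = f y"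
        by eventually_elim (use f[of n] f[of "n - 1"] in \<open>auto simp: glue_def\<close>)
      have "P (n - 1) (a n) = P n (a n)" using ab(1)[of n] ab(2)[of "n - 1"] by simp
      moreover have "a n \<in> dyadics" using a by (auto simp: ladder_def)
      ultimately have "PL_at (glue (a n) (P (n - 1)) (P n)) x"
        unfolding True by (intro PL_at_glue_joint Pb(2))
      then show ?thesis using PL_at_cong[OF ev] by blast
    qed
  qed
  show thesis using that[of f] mono img PL f by (simp add: PL_between_def)
qed

lemma PL_between_join:
  assumes f: "PL_between {..<\<gamma>} {..<\<gamma>'} f" and g: "PL_between {\<gamma><..} {\<gamma>'<..} g"
  obtains h where "increasing_bij h" "h \<gamma> = \<gamma>'" "\<And>x. x < \<gamma> \<Longrightarrow> h x = f x" "\<And>x. x > \<gamma> \<Longrightarrow> h x = g x"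
    "\<And>x. x \<noteq> \<gamma> \<Longrightarrow> PL_at h x"
proof -
  define h where "h x = (if x < \<gamma> then f x else if x = \<gamma> then \<gamma>' else g x)" for x
  have fl: "f x < \<gamma>'" if "x < \<gamma>" for x using f that by (auto simp: PL_between_def)
  have gl: "\<gamma>' < g x" if "\<gamma> < x" for x using g that by (auto simp: PL_between_def)
  have "strict_mono h"
  proof (rule strict_monoI)
    fix x y :: real assume "x < y"
    then show "h x < h y" using fl[of x] gl[of y] f g
      by (auto simp: h_def PL_between_def intro: less_trans)
  qed
  moreover have "\<exists>x. y = h x" for y
  proof (cases y \<gamma>' rule: linorder_cases)
    case less
    then have "y \<in> f ` {..<\<gamma>}" using f by (simp add: PL_between_def)
    then obtain x where "x < \<gamma>" "y = f x" by auto
    then show ?thesis by (intro exI[of _ x]) (simp add: h_def)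
  next
    case equal
    then show ?thesis by (intro exI[of _ \<gamma>]) (simp add: h_def)
  next
    case greater
    then have "y \<in> g ` {\<gamma><..}" using g by (simp add: PL_between_def)
    then obtain x where "\<gamma> < x" "y = g x" by auto
    then show ?thesis by (intro exI[of _ x]) (simp add: h_def)
  qed
  ultimately have "increasing_bij h" unfolding increasing_bij_def surj_def by blast
  moreover have "PL_at h x" if "x \<noteq> \<gamma>" for x
  proof (cases "x < \<gamma>")
    case True
    have "\<forall>\<^sub>F y in nhds x. y \<in> {..<\<gamma>}" using True by (intro eventually_nhds_in_open) auto
    then have "\<forall>\<^sub>F y in nhds x. f y = h y" by eventually_elim (simp add: h_def)
    then show ?thesis using PL_at_cong f True by (auto simp: PL_between_def)
  next
    case False
    then have "\<gamma> < x" using that by simp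
    then have "\<forall>\<^sub>F y in nhds x. y \<in> {\<gamma><..}" by (intro eventually_nhds_in_open) auto
    then have "\<forall>\<^sub>F y in nhds x. g y = h y" by eventually_elim (simp add: h_def)
    then show ?thesis using PL_at_cong g \<open>\<gamma> < x\<close> by (auto simp: PL_between_def)
  qed
  ultimately show thesis by (intro that[of h]) (auto simp: h_def)
qed

section \<open>Matching non-dyadic points\<close>

text \<open>One dyadic number is picked between \<open>\<gamma> + 2\<^sup>n\<close> and \<open>\<gamma> + 2\<^sup>n\<^sup>+\<^sup>1\<close> for each integer \<open>n\<close>.\<close>

lemma ladder_above_exists: obtains a where "ladder a {\<gamma><..}"
proof -
  have "\<exists>d. d \<in> dyadics \<and> \<gamma> + 2 powi n < d \<and> d < \<gamma> + 2 powi (n + 1)" for n :: int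
  proof -
    have "\<gamma> + 2 powi n < \<gamma> + 2 powi (n + 1)" by (simp add: power_int_add)
    then show ?thesis using dyadics_dense by metis
  qed
  then obtain a where a: "\<And>n. a n \<in> dyadics" "\<And>n. \<gamma> + 2 powi n < a n" "\<And>n. a n < \<gamma> + 2 powi (n + 1)"
    by metis
  have "a n < a (n + 1)" for n using a(2)[of "n + 1"] a(3)[of n] by simp
  then have mono: "strict_mono a" by (rule strict_mono_int_step)
  have "(\<gamma> < x) \<longleftrightarrow> (\<exists>m n. a m < x \<and> x < a n)" for x
  proof
    assume x: "\<gamma> < x"
    obtain N where N: "x - \<gamma> < 2 ^ N" using real_arch_pow[of 2 "x - \<gamma>"] by auto
    obtain M where M: "(1/2) ^ M < x - \<gamma>" using real_arch_pow_inv[of "x - \<gamma>" "1/2"] x by auto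
    have "a (- int M - 1) < x" using a(3)[of "- int M - 1"] M by (simp add: power_int_minus power_one_over inverse_eq_divide)
    moreover have "x < a (int N)" using a(2)[of "int N"] N by simp
    ultimately show "\<exists>m n. a m < x \<and> x < a n" by blast
  next
    assume "\<exists>m n. a m < x \<and> x < a n"
    then obtain m where "a m < x" by blast
    moreover have "\<gamma> < a m" using a(2)[of m] zero_less_power_int[of "2::real" m] by linarith
    ultimately show "\<gamma> < x" by linarith
  qed
  then show thesis using that[of a] mono a(1) by (auto simp: ladder_def)
qed

lemma ladder_below_exists: obtains a where "ladder a {..<\<gamma>}"
proof -
  obtain a where "ladder a {- \<gamma><..}" using ladder_above_exists .
  from ladder_reflect[OF this] have "ladder (\<lambda>n. - a (- n)) {..<\<gamma>}" by (simp add: lessThan_def)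
  then show thesis by (rule that)
qed

text \<open>Any map assembled along ladders on both sides will do: the only germ of a dyadic dilation at an
irrational point is the identity, so there is nothing to intertwine.\<close>

lemma match_irrational:
  assumes "\<gamma> \<notin> \<rat>" "\<gamma>' \<notin> \<rat>"
  obtains h where "increasing_bij h" "h \<gamma> = \<gamma>'" "\<And>x. x \<noteq> \<gamma> \<Longrightarrow> PL_at h x" "intertwines h \<gamma>"
proof -
  have ex: "\<exists>f. PL_between S T f" if a: "ladder a S" and b: "ladder b T" for a b S T
  proof -
    have "\<exists>p. PL_homeo p \<and> p (a n) = b n \<and> p (a (n + 1)) = b (n + 1)" for n
      using ladder_step_PL_homeo[OF a b] by metis
    then obtain P where "\<And>n. PL_homeo (P n)" "\<And>n. P n (a n) = b n" "\<And>n. P n (a (n + 1)) = b (n + 1)"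
      by metis
    then show ?thesis using ladder_assemble[OF a b] by metis
  qed
  obtain f where f: "PL_between {..<\<gamma>} {..<\<gamma>'} f" using ex ladder_below_exists by metis
  obtain g where g: "PL_between {\<gamma><..} {\<gamma>'<..} g" using ex ladder_above_exists by metis
  obtain h where h: "increasing_bij h" "h \<gamma> = \<gamma>'" "\<And>x. x \<noteq> \<gamma> \<Longrightarrow> PL_at h x"
    using PL_between_join[OF f g] by metis
  have "intertwines h \<gamma>" using assms h(2) by (simp add: intertwines_def dilation_exps_irrational)
  then show thesis using that h by blast
qed

text \<open>The orbit of a dyadic number under a dilation that is a dyadic affine map.\<close>

lemma ladder_dilation_above:
  assumes e: "e > 0" "e \<in> dilation_exps \<gamma>" and s: "s \<in> dyadics" "s > \<gamma>"
  shows "ladder (\<lambda>n. dilation \<gamma> (e * n) s) {\<gamma><..}"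
proof -
  define a where "a n = dilation \<gamma> (e * n) s" for n
  have "a n < a (n + 1)" for n
    using e s power_int_strict_increasing[of "e * n" "e * (n + 1)" "2::real"] by (simp add: a_def dilation_def)
  then have mono: "strict_mono a" by (rule strict_mono_int_step)
  have dy: "a n \<in> dyadics" for n
    using dyadic_affine_dyadics_iff[of "dilation \<gamma> (e * n)" s] dilation_exps_mult[OF e(2), of n] s(1)
    by (simp add: a_def dilation_exps_def)
  have "(\<gamma> < x) \<longleftrightarrow> (\<exists>m n. a m < x \<and> x < a n)" for x
  proof
    assume x: "\<gamma> < x"
    define u where "u = (x - \<gamma>) / (s - \<gamma>)"
    have u: "u > 0" using x s by (simp add: u_def)
    have le: "int N \<le> e * int N" for N using e(1) mult_right_mono[of 1 e "int N"] by simp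
    obtain N where N: "u < 2 ^ N" using real_arch_pow[of 2 u] by auto
    also have "(2::real) ^ N = 2 powi int N" by simp
    also have "\<dots> \<le> 2 powi (e * int N)" using le by (intro power_int_increasing) auto
    finally have upper: "x < a (int N)" using s by (simp add: u_def a_def dilation_def field_simps)
    obtain M where M: "(1/2) ^ M < u" using real_arch_pow_inv[of u "1/2"] u by auto
    have "(2::real) powi (e * (- int M)) \<le> 2 powi (- int M)" using le[of M] by (intro power_int_increasing) auto
    also have "(2::real) powi (- int M) = (1/2) ^ M" by (simp add: power_int_minus power_one_over inverse_eq_divide)
    also note M
    finally have "a (- int M) < x" using s by (simp add: u_def a_def dilation_def field_simps)
    with upper show "\<exists>m n. a m < x \<and> x < a n" by blast
  next
    assume "\<exists>m n. a m < x \<and> x < a n"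
    then obtain m where "a m < x" by blast
    moreover have "\<gamma> < a m" using s by (simp add: a_def dilation_def)
    ultimately show "\<gamma> < x" by linarith
  qed
  then have "ladder a {\<gamma><..}" using mono dy by (auto simp: ladder_def)
  then show ?thesis by (simp add: a_def[abs_def])
qed

lemma dilation_exps_uminus: "dilation_exps (- \<gamma>) = dilation_exps \<gamma>"
  using dyadics_minus[of "(2 powi k - 1) * \<gamma>" for k] dyadics_minus[of "- ((2 powi k - 1) * \<gamma>)" for k]
  by (auto simp: dilation_exps_iff)

lemma ladder_dilation_below:
  assumes e: "e < 0" "e \<in> dilation_exps \<gamma>" and s: "s \<in> dyadics" "s < \<gamma>"
  shows "ladder (\<lambda>n. dilation \<gamma> (e * n) s) {..<\<gamma>}"
proof -
  have "- e \<in> dilation_exps (- \<gamma>)" using e(2) dilation_exps_minus by (simp add: dilation_exps_uminus)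
  then have "ladder (\<lambda>n. dilation (- \<gamma>) (- e * n) (- s)) {- \<gamma><..}"
    using e s by (intro ladder_dilation_above dyadics_minus) auto
  from ladder_reflect[OF this] show ?thesis by (simp add: lessThan_def dilation_def algebra_simps)
qed

text \<open>A piecewise linear map from one fundamental domain of the dilation at \<open>\<gamma>\<close> to one at \<open>\<gamma>'\<close> is
transported to all translates of the domain by powers of the two dilations.\<close>

lemma PL_between_equivariant:
  assumes e: "e \<in> dilation_exps \<gamma>" "e' \<in> dilation_exps \<gamma>'"
    and a: "ladder (\<lambda>n. dilation \<gamma> (e * n) s) S" and b: "ladder (\<lambda>n. dilation \<gamma>' (e' * n) s') T"
  obtains f where "PL_between S T f"
    "\<And>m x. x \<in> S \<Longrightarrow> f (dilation \<gamma> (e * m) x) = dilation \<gamma>' (e' * m) (f x)"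
proof -
  define A where "A n = dilation \<gamma> (e * n) s" for n
  define B where "B n = dilation \<gamma>' (e' * n) s'" for n
  have A: "ladder A S" and B: "ladder B T" using a b by (simp_all add: A_def[abs_def] B_def[abs_def])
  have aff: "dilation \<gamma> (e * n) \<in> dyadic_affine" "dilation \<gamma>' (e' * n) \<in> dyadic_affine" for n
    using dilation_exps_mult e by (auto simp: dilation_exps_def)
  have Ashift: "dilation \<gamma> (e * m) (A n) = A (n + m)" for m n
    by (simp add: A_def dilation_dilation algebra_simps)
  have Bshift: "dilation \<gamma>' (e' * m) (B n) = B (n + m)" for m n
    by (simp add: B_def dilation_dilation algebra_simps)
  obtain p where p: "PL_homeo p" "p (A 0) = B 0" "p (A 1) = B 1"
    using ladder_step_PL_homeo[OF A B, of 0] by auto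
  define P where "P n = dilation \<gamma>' (e' * n) \<circ> (p \<circ> dilation \<gamma> (e * (- n)))" for n
  have "PL_homeo (P n)" for n
    unfolding P_def by (intro PL_homeo_comp PL_homeo_affine aff p)
  moreover have "P n (A n) = B n" "P n (A (n + 1)) = B (n + 1)" for n
    using Ashift[of "- n" n] Ashift[of "- n" "n + 1"] Bshift[of n 0] Bshift[of n 1] p(2,3)
    by (simp_all add: P_def add.commute)
  ultimately obtain f where f: "PL_between S T f"
    and fP: "\<And>n x. A n \<le> x \<Longrightarrow> x \<le> A (n + 1) \<Longrightarrow> f x = P n x"
    using ladder_assemble[OF A B] by metis
  have "f (dilation \<gamma> (e * m) x) = dilation \<gamma>' (e' * m) (f x)" if x: "x \<in> S" for m x
  proof -
    obtain n where n: "A n \<le> x" "x < A (n + 1)" using ladder_rung[OF A x] .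
    have "A (n + m) \<le> dilation \<gamma> (e * m) x" "dilation \<gamma> (e * m) x \<le> A (n + m + 1)"
      using n increasing_bij_le_iff[OF increasing_bij_affine[OF aff(1)], of m]
        Ashift[of m n] Ashift[of m "n + 1"] by (metis, metis add.assoc add.commute less_imp_le)
    then have "f (dilation \<gamma> (e * m) x) = P (n + m) (dilation \<gamma> (e * m) x)" by (rule fP)
    also have "\<dots> = dilation \<gamma>' (e' * m) (P n x)"
      by (simp add: P_def dilation_dilation algebra_simps)
    finally show ?thesis using fP[of n x] n by simp
  qed
  then show thesis using that f by blast
qed

text \<open>The generators of the two groups of dilations have different factors in general. They are matched
with each other, separately on both sides of the point.\<close>

lemma match_rational:
  assumes "\<gamma> \<in> \<rat>" "\<gamma>' \<in> \<rat>"
  obtains h where "increasing_bij h" "h \<gamma> = \<gamma>'" "\<And>x. x \<noteq> \<gamma> \<Longrightarrow> PL_at h x" "intertwines h \<gamma>"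
proof -
  obtain d where d: "d > 0" "dilation_exps \<gamma> = range (\<lambda>m. d * m)" using dilation_exps_rational[OF assms(1)] .
  obtain d' where d': "d' > 0" "dilation_exps \<gamma>' = range (\<lambda>m. d' * m)" using dilation_exps_rational[OF assms(2)] .
  have mem: "d \<in> dilation_exps \<gamma>" "- d \<in> dilation_exps \<gamma>" "d' \<in> dilation_exps \<gamma>'" "- d' \<in> dilation_exps \<gamma>'"
    unfolding d(2) d'(2) using rangeI[of "\<lambda>m. d * m" 1] rangeI[of "\<lambda>m. d * m" "- 1"]
      rangeI[of "\<lambda>m. d' * m" 1] rangeI[of "\<lambda>m. d' * m" "- 1"] by auto
  have below: "\<exists>s. s \<in> dyadics \<and> s < x" for x
    using dyadics_dense[of "x - 1" x] by force
  have above: "\<exists>t. t \<in> dyadics \<and> x < t" for x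
    using dyadics_dense[of x "x + 1"] by force
  \<comment> \<open>Below the point an orbit increases under contraction, hence the negative exponents there.\<close>
  obtain s s' where s: "s \<in> dyadics" "s < \<gamma>" "s' \<in> dyadics" "s' < \<gamma>'"
    using below by meson
  obtain t t' where t: "t \<in> dyadics" "\<gamma> < t" "t' \<in> dyadics" "\<gamma>' < t'"
    using above by meson
  have "ladder (\<lambda>n. dilation \<gamma> (- d * n) s) {..<\<gamma>}" "ladder (\<lambda>n. dilation \<gamma>' (- d' * n) s') {..<\<gamma>'}"
    using ladder_dilation_below[OF _ mem(2) s(1,2)] ladder_dilation_below[OF _ mem(4) s(3,4)]
      d(1) d'(1) by simp_all
  then obtain f where f: "PL_between {..<\<gamma>} {..<\<gamma>'} f"
    "\<And>m x. x \<in> {..<\<gamma>} \<Longrightarrow> f (dilation \<gamma> (- d * m) x) = dilation \<gamma>' (- d' * m) (f x)"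
    using PL_between_equivariant[OF mem(2,4)] by blast
  have "ladder (\<lambda>n. dilation \<gamma> (d * n) t) {\<gamma><..}" "ladder (\<lambda>n. dilation \<gamma>' (d' * n) t') {\<gamma>'<..}"
    using ladder_dilation_above[OF d(1) mem(1) t(1,2)]
      ladder_dilation_above[OF d'(1) mem(3) t(3,4)] .
  then obtain g where g: "PL_between {\<gamma><..} {\<gamma>'<..} g"
    "\<And>m x. x \<in> {\<gamma><..} \<Longrightarrow> g (dilation \<gamma> (d * m) x) = dilation \<gamma>' (d' * m) (g x)"
    using PL_between_equivariant[OF mem(1,3)] by blast
  obtain h where h: "increasing_bij h" "h \<gamma> = \<gamma>'" "\<And>x. x < \<gamma> \<Longrightarrow> h x = f x" "\<And>x. x > \<gamma> \<Longrightarrow> h x = g x"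
    "\<And>x. x \<noteq> \<gamma> \<Longrightarrow> PL_at h x" using PL_between_join[OF f(1) g(1)] by blast
  have eq: "h (dilation \<gamma> (d * m) x) = dilation \<gamma>' (d' * m) (h x)" for m x
  proof (cases x \<gamma> rule: linorder_cases)
    case less
    then have "dilation \<gamma> (d * m) x < \<gamma>" by (simp add: dilation_def mult_less_0_iff)
    then show ?thesis using f(2)[of x "- m"] less h(3) by simp
  next
    case equal
    then show ?thesis by (simp add: h(2))
  next
    case greater
    then have "dilation \<gamma> (d * m) x > \<gamma>" by (simp add: dilation_def)
    then show ?thesis using g(2)[of x m] greater h(4) by simp
  qed
  have "intertwines h \<gamma>"
    unfolding intertwines_def h(2) d(2) d'(2) using eq by (auto intro!: always_eventually)
  then show thesis using that h by blast
qed

section \<open>Matching finite sets of points\<close>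

text \<open>One step of the induction on the number of points: \<open>\<theta>\<close> is right from \<open>a\<close> to a dyadic point \<open>r\<close>
before the next point of \<open>U\<close>, and \<open>\<theta> r\<close> lies before the next point of \<open>V\<close>. A dyadic \<open>\<gamma>\<close> can
serve as \<open>r\<close> itself. Otherwise the local solution at \<open>\<gamma>\<close> is kept from a dyadic \<open>l < \<gamma>\<close> on and
replaced to the left of \<open>l\<close> by a piecewise linear map that takes \<open>a\<close> to \<open>a'\<close>.\<close>

lemma extend_over_point:
  assumes ad: "a \<in> dyadics" "a' \<in> dyadics" and lt: "a < \<gamma>" "a' < \<gamma>'" "\<gamma> < u" "\<gamma>' < u'"
    and letter: "letter \<gamma> = letter \<gamma>'"
  obtains \<theta> r where "increasing_bij \<theta>" "\<theta> a = a'" "\<theta> \<gamma> = \<gamma>'" "\<And>x. x \<noteq> \<gamma> \<Longrightarrow> PL_at \<theta> x"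
    "regular_at \<theta> \<gamma>" "r \<in> dyadics" "PL_at \<theta> r" "\<gamma> \<le> r" "r < u" "\<theta> r < u'"
proof (cases "\<gamma> \<in> dyadics")
  case True
  then have "\<gamma>' \<in> dyadics" using letter by (auto simp: letter_def split: if_splits)
  then obtain \<theta> where "PL_homeo \<theta>" "\<theta> a = a'" "\<theta> \<gamma> = \<gamma>'"
    using PL_homeo_interval[OF ad(1) True ad(2) _ lt(1,2)] by metis
  then show thesis using that[of \<theta> \<gamma>] True lt by (simp add: PL_homeo_def regular_at_def)
next
  case False
  then have nd: "\<gamma> \<notin> dyadics" "\<gamma>' \<notin> dyadics" "\<gamma> \<in> \<rat> \<longleftrightarrow> \<gamma>' \<in> \<rat>"
    using letter by (auto simp: letter_def split: if_splits)
  obtain h where h: "increasing_bij h" "h \<gamma> = \<gamma>'" "\<And>x. x \<noteq> \<gamma> \<Longrightarrow> PL_at h x" "intertwines h \<gamma>"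
    using match_rational[of \<gamma> \<gamma>'] match_irrational[of \<gamma> \<gamma>'] nd(3) by blast
  note inv = increasing_bij_f_inv[OF h(1)]
  \<comment> \<open>The bounds leave room for the image of \<open>l\<close> above \<open>a'\<close> and that of \<open>r\<close> below \<open>u'\<close>.\<close>
  have "max a (rinv h a') < \<gamma>"
    using lt h(2) increasing_bij_less_iff[OF h(1), of "rinv h a'" \<gamma>] by (simp add: inv)
  then obtain l where l: "l \<in> dyadics" "max a (rinv h a') < l" "l < \<gamma>" using dyadics_dense by metis
  have "\<gamma> < min u (rinv h u')"
    using lt h(2) increasing_bij_less_iff[OF h(1), of \<gamma> "rinv h u'"] by (simp add: inv)
  then obtain r where r: "r \<in> dyadics" "\<gamma> < r" "r < min u (rinv h u')" using dyadics_dense by metis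
  have PLl: "PL_at h l" and PLr: "PL_at h r" using h(3) l(3) r(2) by auto
  have "a' < h l" using l increasing_bij_less_iff[OF h(1), of "rinv h a'" l] by (simp add: inv)
  moreover have "h l \<in> dyadics" using PL_at_dyadics_iff[OF PLl] l(1) by simp
  ultimately obtain p where p: "PL_homeo p" "p a = a'" "p l = h l"
    using PL_homeo_interval[OF ad(1) l(1) ad(2)] l(2) by (metis max_less_iff_conj)
  define \<theta> where "\<theta> = glue l p h"
  have near: "\<forall>\<^sub>F y in nhds x. h y = \<theta> y" if "l < x" for x
    unfolding \<theta>_def using glue_near_right[OF that] .
  have "PL_at \<theta> x" if "x \<noteq> \<gamma>" for x
  proof (cases x l rule: linorder_cases)
    case less
    then show ?thesis using PL_at_cong[OF glue_near_left[OF less]] p(1) by (simp add: \<theta>_def PL_homeo_def)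
  next
    case equal
    then show ?thesis using PL_at_glue_joint[of p l h] PLl p(1,3) l(1) by (simp add: \<theta>_def PL_homeo_def)
  next
    case greater
    then show ?thesis using PL_at_cong[OF near] h(3) that by blast
  qed
  moreover have "regular_at \<theta> \<gamma>"
    using regular_at_cong[OF near[OF l(3)]] h(2,4) nd by (simp add: regular_at_def)
  moreover have "increasing_bij \<theta>"
    unfolding \<theta>_def using increasing_bij_glue[of p h l] h(1) p(1,3) by (simp add: PL_homeo_def)
  moreover have "\<theta> a = a'" "\<theta> \<gamma> = \<gamma>'" "\<theta> r = h r" using l r p h by (auto simp: \<theta>_def glue_def)
  moreover have "h r < u'" using r increasing_bij_less_iff[OF h(1), of r "rinv h u'"] by (simp add: inv)
  moreover have "PL_at \<theta> r" using PL_at_cong[OF near[of r] PLr] l r by simp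
  ultimately show thesis using that[of \<theta> r] r by simp
qed

lemma gap_above:
  fixes x :: real
  assumes "finite S" "\<And>z. z \<in> S \<Longrightarrow> x < z"
  obtains u where "x < u" "\<And>z. z \<in> S \<Longrightarrow> u \<le> z"
proof (cases "S = {}")
  case True
  then show thesis using that[of "x + 1"] by simp
next
  case False
  then show thesis using that[of "Min S"] assms by auto
qed

text \<open>The left ends \<open>a\<close> and \<open>a'\<close> vary in the induction on the list of points: after the first point has
been dealt with, they move to \<open>r\<close> and its image.\<close>

lemma matching_map_exists:
  assumes "sorted_wrt (<) xs" "sorted_wrt (<) ys" "map letter xs = map letter ys"
    "a \<in> dyadics" "b \<in> dyadics" "a' \<in> dyadics" "b' \<in> dyadics" "a < b" "a' < b'"
    "set xs \<subseteq> {a<..<b}" "set ys \<subseteq> {a'<..<b'}"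
  shows "\<exists>\<phi>. increasing_bij \<phi> \<and> \<phi> a = a' \<and> \<phi> b = b' \<and> map \<phi> xs = ys \<and>
           (\<forall>x. x \<notin> set xs \<longrightarrow> PL_at \<phi> x) \<and> (\<forall>x. regular_at \<phi> x)"
  using assms
proof (induction xs arbitrary: ys a a')
  case Nil
  obtain \<phi> where "PL_homeo \<phi>" "\<phi> a = a'" "\<phi> b = b'"
    using PL_homeo_interval Nil.prems(4-9) by metis
  then show ?case using Nil.prems(3) by (auto simp: PL_homeo_def regular_at_def)
next
  case (Cons x xs)
  obtain y ys' where ys: "ys = y # ys'" using Cons.prems(3) by (cases ys) auto
  have x: "a < x" "x < b" "\<And>z. z \<in> set xs \<Longrightarrow> x < z" using Cons.prems(1,10) by auto
  have y: "a' < y" "y < b'" "\<And>z. z \<in> set ys' \<Longrightarrow> y < z" using Cons.prems(2,11) ys by auto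
  obtain u where u: "x < u" "\<And>z. z \<in> insert b (set xs) \<Longrightarrow> u \<le> z"
    using gap_above[of "insert b (set xs)" x] x by auto
  obtain u' where u': "y < u'" "\<And>z. z \<in> insert b' (set ys') \<Longrightarrow> u' \<le> z"
    using gap_above[of "insert b' (set ys')" y] y by auto
  have "letter x = letter y" using Cons.prems(3) ys by simp
  then obtain \<theta> r where \<theta>: "increasing_bij \<theta>" "\<theta> a = a'" "\<theta> x = y" "\<And>z. z \<noteq> x \<Longrightarrow> PL_at \<theta> z"
    "regular_at \<theta> x" and r: "r \<in> dyadics" "PL_at \<theta> r" "x \<le> r" "r < u" "\<theta> r < u'"
    using extend_over_point[OF Cons.prems(4,6) x(1) y(1) u(1) u'(1)] by metis
  have r': "\<theta> r \<in> dyadics" "r < b" "\<theta> r < b'" "\<And>z. z \<in> set xs \<Longrightarrow> r < z" "\<And>z. z \<in> set ys' \<Longrightarrow> \<theta> r < z"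
    using PL_at_dyadics_iff[OF r(2)] r u(2) u'(2) by fastforce+
  obtain \<psi> where \<psi>: "increasing_bij \<psi>" "\<psi> r = \<theta> r" "\<psi> b = b'" "map \<psi> xs = ys'"
      "\<And>z. z \<notin> set xs \<Longrightarrow> PL_at \<psi> z" "\<And>z. regular_at \<psi> z"
    using Cons.IH[of ys' r "\<theta> r"] Cons.prems ys r r' by (auto simp: subset_iff)
  define \<phi> where "\<phi> = glue r \<theta> \<psi>"
  have "r \<notin> set xs" using r'(4) by blast
  then have joint: "PL_at \<phi> r"
    unfolding \<phi>_def using PL_at_glue_joint[OF r(2) \<psi>(5)] \<psi>(2) r(1) by simp
  have reg: "regular_at \<phi> z" for z
  proof (cases z r rule: linorder_cases)
    case less
    have "regular_at \<theta> z" using \<theta>(4,5) by (cases "z = x") (auto simp: regular_at_def)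
    then show ?thesis unfolding \<phi>_def using regular_at_cong[OF glue_near_left[OF less]] by blast
  next
    case equal
    then show ?thesis using joint by (simp add: regular_at_def)
  next
    case greater
    then show ?thesis unfolding \<phi>_def using regular_at_cong[OF glue_near_right] \<psi>(6) by blast
  qed
  have PL: "PL_at \<phi> z" if "z \<notin> set (x # xs)" for z
  proof (cases z r rule: linorder_cases)
    case less
    then show ?thesis unfolding \<phi>_def using PL_at_cong[OF glue_near_left[OF less]] \<theta>(4) that by simp
  next
    case equal
    then show ?thesis using joint by simp
  next
    case greater
    then show ?thesis unfolding \<phi>_def using PL_at_cong[OF glue_near_right] \<psi>(5) that by simp
  qed
  have "map \<phi> xs = map \<psi> xs" using r'(4) by (force simp: \<phi>_def glue_def)
  then have "map \<phi> (x # xs) = ys" using ys \<psi>(4) \<theta>(3) r(3) by (simp add: \<phi>_def glue_def)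
  moreover have "\<phi> a = a'" "\<phi> b = b'" using \<theta>(2) \<psi>(3) x(1) r(3) r'(2) by (auto simp: \<phi>_def glue_def)
  moreover have "increasing_bij \<phi>" unfolding \<phi>_def using increasing_bij_glue \<theta>(1) \<psi>(1,2) by simp
  ultimately show ?case using reg PL by blast
qed

theorem theorem4p1:
  fixes U V :: "real set"
  assumes "finite U" and "U \<subseteq> {0<..<1}"
    and "finite V" and "V \<subseteq> {0<..<1}"
    and "\<tau> U = \<tau> V"
  shows "thompson_F\<lparr>carrier := H U\<rparr> \<cong> thompson_F\<lparr>carrier := H V\<rparr>"
proof -
  define xs where "xs = sorted_list_of_set U"
  define ys where "ys = sorted_list_of_set V"
  have sets: "set xs = U" "set ys = V" using assms by (auto simp: xs_def ys_def)
  have "\<exists>\<phi>. increasing_bij \<phi> \<and> \<phi> 0 = 0 \<and> \<phi> 1 = 1 \<and> map \<phi> xs = ys \<and>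
           (\<forall>x. x \<notin> set xs \<longrightarrow> PL_at \<phi> x) \<and> (\<forall>x. regular_at \<phi> x)"
  proof (rule matching_map_exists)
    show "sorted_wrt (<) xs" "sorted_wrt (<) ys" by (auto simp: xs_def ys_def)
    show "map letter xs = map letter ys" using assms(5) by (simp add: \<tau>_def xs_def ys_def)
  qed (use assms sets in auto)
  then obtain \<phi> where \<phi>: "increasing_bij \<phi>" "\<phi> 0 = 0" "\<phi> 1 = 1" "map \<phi> xs = ys"
    "\<And>x. x \<notin> U \<Longrightarrow> PL_at \<phi> x" "\<And>x. regular_at \<phi> x" using sets by blast
  have "\<phi> ` U = V" using \<phi>(4) sets by (metis set_map)
  then show ?thesis using H_iso_if_conjugating_map[OF \<phi>(1-3) \<phi>(5,6)] assms(2,4) by blast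
qed

end
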